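(* Let $n>2$. Any simple linearly compact $n$-Nambu-Poisson algebra over $\mathbb{F}$ is isomorphic to the algebra $\mathbb{F}[[x_1,\dots,x_n]]$ (with its usual commutative associative product) endowed with the $n$-ary bracket $$\{f_1,\dots,f_n\}=\det\left(\frac{\partial f_i}{\partial x_j}\right)_{i,j=1}^n .$$
   Context: The base field $\mathbb{F}$ is algebraically closed of characteristic $0$. An $n$-Lie algebra is a vector space with an $n$-linear skew-symmetric bracket $\{\cdot,\dots,\cdot\}$ satisfying the Filippov-Jacobi identity $\{a_1,\dots,a_{n-1},\{b_1,\dots,b_n\}\}=\sum_{i=1}^n\{b_1,\dots,b_{i-1},\{a_1,\dots,a_{n-1},b_i\},b_{i+1},\dots,b_n\}$. An $n$-Nambu-Poisson algebra is a triple $(\mathcal{N},\{\cdot,\dots,\cdot\},\cdot)$ such that $(\mathcal{N},\cdot)$ is a unital commutative associative algebra, $(\mathcal{N},\{\cdot,\dots,\cdot\})$ is an $n$-Lie algebra, and the Leibniz rule $\{a_1,\dots,a_{n-1},bc\}=\{a_1,\dots,a_{n-1},b\}c+b\{a_1,\dots,a_{n-1},c\}$ holds. Simple means: the bracket is not identically zero and the only subspaces $I$ with $\mathcal{N}\cdot I\subseteq I$ and $\{I,\mathcal{N},\dots,\mathcal{N}\}\subseteq I$ are $0$ and $\mathcal{N}$. Linearly compact means: $\mathcal{N}$ is a topological algebra (product and bracket continuous) whose underlying topological vector space is linearly compact, i.e. isomorphic to a topological product of finite-dimensional discrete vector spaces ($\mathbb{F}$ being discrete). *)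

theory Defs
  imports
    "HOL-Analysis.Analysis"
    "HOL-Library.Multiset"
    "HOL-Computational_Algebra.Polynomial"
begin

section \<open>Nambu-Poisson algebras\<close>

text \<open>
  The arguments of an $n$-ary bracket are families indexed by a finite type \<open>'n\<close> with
  \<open>CARD('n) = n\<close>. In the axioms below the argument slot \<open>k\<close> is arbitrary; by skew-symmetry
  asking for one slot \<open>k\<close> (say, the last one) is equivalent to asking for all of them; the same
  applies to the slot in the definition of ideals.
\<close>

locale n_lie_algebra = vector_space smul
  for smul :: "'f::field \<Rightarrow> 'a::ab_group_add \<Rightarrow> 'a" +
  fixes bracket :: "('n::finite \<Rightarrow> 'a) \<Rightarrow> 'a"
  assumes multilinear: "Vector_Spaces.linear smul smul (\<lambda>x. bracket (a(k := x)))"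
    and skew_symmetric: "p permutes UNIV \<Longrightarrow> bracket (a \<circ> p) = smul (of_int (sign p)) (bracket a)"
    and filippov_jacobi:
      "bracket (a(k := bracket b)) = (\<Sum>i\<in>UNIV. bracket (b(i := bracket (a(k := b i)))))"

locale nambu_poisson_algebra = n_lie_algebra smul bracket
  for smul :: "'f::field \<Rightarrow> 'a::comm_ring_1 \<Rightarrow> 'a"
    and bracket :: "('n::finite \<Rightarrow> 'a) \<Rightarrow> 'a" +
  assumes smul_mult: "smul c (x * y) = smul c x * y"
    and leibniz: "bracket (a(k := x * y)) = bracket (a(k := x)) * y + x * bracket (a(k := y))"
begin

definition np_ideal :: "'a set \<Rightarrow> bool" where
  "np_ideal I \<longleftrightarrow> subspace I \<and> (\<forall>x\<in>I. \<forall>y. y * x \<in> I) \<and> (\<forall>a k. a k \<in> I \<longrightarrow> bracket a \<in> I)"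

definition simple :: bool where
  "simple \<longleftrightarrow> (\<exists>a. bracket a \<noteq> 0) \<and> (\<forall>I. np_ideal I \<longrightarrow> I = {0} \<or> I = UNIV)"

end


section \<open>Linear compactness\<close>

text \<open>
  The factors \<open>V i\<close> and the index set \<open>I\<close> are taken inside the space itself. This is no
  restriction: zero factors may be dropped from a product, and each remaining factor embeds
  into the product as a coordinate subspace, which also yields an injection of the index set.
  The factors being discrete, continuity of addition and of scalar multiplication
  (for the discrete topology on the field) is automatic.
\<close>

definition (in vector_space) linearly_compact :: "'b topology \<Rightarrow> bool" where
  "linearly_compact T \<longleftrightarrow> topspace T = UNIV \<and>
     (\<exists>(I :: 'b set) (V :: 'b \<Rightarrow> 'b set) (\<phi> :: 'b \<Rightarrow> 'b \<Rightarrow> 'b).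
        (\<forall>i\<in>I. \<exists>B. finite B \<and> V i = span B) \<and>
        (\<forall>i\<in>I. Vector_Spaces.linear scale scale (\<lambda>x. \<phi> x i)) \<and>
        homeomorphic_map T (product_topology (\<lambda>i. discrete_topology (V i)) I) \<phi>)"

locale linearly_compact_nambu_poisson_algebra = nambu_poisson_algebra smul bracket
  for smul :: "'f::field \<Rightarrow> 'a::comm_ring_1 \<Rightarrow> 'a"
    and bracket :: "('n::finite \<Rightarrow> 'a) \<Rightarrow> 'a" +
  fixes T :: "'a topology"
  assumes linearly_compact: "linearly_compact T"
    and continuous_mult: "continuous_map (prod_topology T T) T (\<lambda>(x, y). x * y)"
    and continuous_bracket: "continuous_map (product_topology (\<lambda>_. T) UNIV) T bracket"


text \<open>Isomorphisms of topological algebras with an \<open>n\<close>-ary bracket.\<close>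

definition nambu_poisson_iso ::
  "('f::field \<Rightarrow> 'a::comm_ring_1 \<Rightarrow> 'a) \<Rightarrow> (('n \<Rightarrow> 'a) \<Rightarrow> 'a) \<Rightarrow> 'a topology \<Rightarrow>
   ('f \<Rightarrow> 'b::comm_ring_1 \<Rightarrow> 'b) \<Rightarrow> (('n \<Rightarrow> 'b) \<Rightarrow> 'b) \<Rightarrow> 'b topology \<Rightarrow> ('a \<Rightarrow> 'b) \<Rightarrow> bool" where
  "nambu_poisson_iso smul bracket T smul' bracket' T' \<phi> \<longleftrightarrow>
     bij \<phi> \<and> Vector_Spaces.linear smul smul' \<phi> \<and>
     \<phi> 1 = 1 \<and> (\<forall>x y. \<phi> (x * y) = \<phi> x * \<phi> y) \<and>
     (\<forall>a. \<phi> (bracket a) = bracket' (\<phi> \<circ> a)) \<and>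
     homeomorphic_map T T' \<phi>"


section \<open>Formal power series in several variables\<close>

text \<open>
  A monomial in the variables $x_i$, \<open>i :: 'n\<close>, is the multiset of its variables, so that
  addition of multisets is multiplication of monomials and \<open>count M i\<close> is the exponent of $x_i$.
\<close>

typedef ('f, 'n) mfps = "UNIV :: ('n multiset \<Rightarrow> 'f) set"
  morphisms mfps_coeff Abs_mfps by simp

setup_lifting type_definition_mfps

lemma mfps_eq_iff: "f = g \<longleftrightarrow> (\<forall>M. mfps_coeff f M = mfps_coeff g M)"
  by transfer auto

lemma finite_splittings_mset: "finite {(A, B). A + B = (M :: 'n multiset)}"
proof -
  have "{(A, B). A + B = M} \<subseteq>
      (\<Union>k\<le>size M. multisets_of_size (set_mset M) k) \<times> (\<Union>k\<le>size M. multisets_of_size (set_mset M) k)"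
    by (auto simp: multisets_of_size_def)
  moreover have "finite \<dots>"
    by (intro finite_cartesian_product finite_UN_I finite_multisets_of_size) auto
  ultimately show ?thesis
    by (rule finite_subset)
qed

lemma splittings_mset_assoc:
  fixes F :: "'n multiset \<Rightarrow> 'n multiset \<Rightarrow> 'n multiset \<Rightarrow> 'r::comm_monoid_add"
  shows "(\<Sum>(D, C) | D + C = M. \<Sum>(A, B) | A + B = D. F A B C) =
         (\<Sum>(A, D) | A + D = M. \<Sum>(B, C) | B + C = D. F A B C)"
proof -
  have "(\<Sum>(D, C) | D + C = M. \<Sum>(A, B) | A + B = D. F A B C) =
        (\<Sum>p\<in>{(D, C). D + C = M}. \<Sum>q\<in>{(A, B). A + B = fst p}. F (fst q) (snd q) (snd p))"
    by (simp add: case_prod_beta)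
  also have "\<dots> = (\<Sum>(p, q)\<in>(SIGMA p:{(D, C). D + C = M}. {(A, B). A + B = fst p}).
      F (fst q) (snd q) (snd p))"
    by (intro sum.Sigma ballI finite_splittings_mset)
  also have "\<dots> = (\<Sum>(p, q)\<in>(SIGMA p:{(A, D). A + D = M}. {(B, C). B + C = snd p}).
      F (fst p) (fst q) (snd q))"
    by (rule sum.reindex_bij_witness
         [where i = "\<lambda>((A, D), (B, C)). ((A + B, C), (A, B))"
            and j = "\<lambda>((D, C), (A, B)). ((A, B + C), (B, C))"]) (auto simp: ac_simps)
  also have "\<dots> = (\<Sum>p\<in>{(A, D). A + D = M}. \<Sum>q\<in>{(B, C). B + C = snd p}.
      F (fst p) (fst q) (snd q))"
    by (intro sum.Sigma[symmetric] ballI finite_splittings_mset)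
  finally show ?thesis
    by (simp add: case_prod_beta)
qed

instantiation mfps :: (comm_ring_1, type) comm_ring_1
begin

lift_definition zero_mfps :: "('a, 'b) mfps" is "\<lambda>_. 0" .
lift_definition one_mfps :: "('a, 'b) mfps" is "\<lambda>M. if M = {#} then 1 else 0" .
lift_definition plus_mfps :: "('a, 'b) mfps \<Rightarrow> ('a, 'b) mfps \<Rightarrow> ('a, 'b) mfps"
  is "\<lambda>f g M. f M + g M" .
lift_definition uminus_mfps :: "('a, 'b) mfps \<Rightarrow> ('a, 'b) mfps" is "\<lambda>f M. - f M" .
lift_definition minus_mfps :: "('a, 'b) mfps \<Rightarrow> ('a, 'b) mfps \<Rightarrow> ('a, 'b) mfps"
  is "\<lambda>f g M. f M - g M" .
lift_definition times_mfps :: "('a, 'b) mfps \<Rightarrow> ('a, 'b) mfps \<Rightarrow> ('a, 'b) mfps"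
  is "\<lambda>f g M. \<Sum>(A, B) | A + B = M. f A * g B" .

instance
proof
  fix f g h :: "('a, 'b) mfps"
  show "f * g * h = f * (g * h)"
    using splittings_mset_assoc[where F = "\<lambda>A B C. mfps_coeff f A * mfps_coeff g B * mfps_coeff h C"]
    by (simp add: mfps_eq_iff times_mfps.rep_eq sum_distrib_left sum_distrib_right case_prod_beta
        mult.assoc)
  show "f * g = g * f"
    unfolding mfps_eq_iff times_mfps.rep_eq
    by (intro allI sum.reindex_bij_witness[where i = prod.swap and j = prod.swap])
       (auto simp: ac_simps)
  show "1 * f = f"
  proof -
    have "(\<Sum>(A, B) | A + B = M. mfps_coeff 1 A * mfps_coeff f B) = mfps_coeff f M" for M :: "'b multiset"
    proof -
      have "(\<Sum>(A, B) | A + B = M. mfps_coeff 1 A * mfps_coeff f B) =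
            (\<Sum>(A, B)\<in>{({#}, M)}. mfps_coeff 1 A * mfps_coeff f B)"
        by (rule sum.mono_neutral_right[OF finite_splittings_mset])
           (auto simp: one_mfps.rep_eq split: if_splits)
      then show ?thesis by (simp add: one_mfps.rep_eq)
    qed
    then show ?thesis by (simp add: mfps_eq_iff times_mfps.rep_eq)
  qed
  show "(f + g) * h = f * h + g * h"
    by (simp add: mfps_eq_iff times_mfps.rep_eq plus_mfps.rep_eq case_prod_beta distrib_right
        sum.distrib)
  show "(0 :: ('a, 'b) mfps) \<noteq> 1"
    by (auto simp: mfps_eq_iff zero_mfps.rep_eq one_mfps.rep_eq)
qed (simp_all add: mfps_eq_iff plus_mfps.rep_eq uminus_mfps.rep_eq minus_mfps.rep_eq
      zero_mfps.rep_eq algebra_simps)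

end

lift_definition mfps_scale :: "'f::comm_ring_1 \<Rightarrow> ('f, 'n) mfps \<Rightarrow> ('f, 'n) mfps"
  is "\<lambda>c f M. c * f M" .

lift_definition mfps_deriv :: "'n \<Rightarrow> ('f::comm_ring_1, 'n) mfps \<Rightarrow> ('f, 'n) mfps"
  is "\<lambda>j f M. of_nat (Suc (count M j)) * f (add_mset j M)" .

text \<open>The product topology on the coefficients, each copy of the field being discrete.\<close>

definition mfps_topology :: "('f, 'n) mfps topology" where
  "mfps_topology =
     pullback_topology UNIV mfps_coeff (product_topology (\<lambda>_. discrete_topology UNIV) UNIV)"

definition jacobian_bracket :: "('n::finite \<Rightarrow> ('f::comm_ring_1, 'n) mfps) \<Rightarrow> ('f, 'n) mfps" where
  "jacobian_bracket f = det (\<chi> i j. mfps_deriv j (f i))"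

end

theory Submission
  imports Defs
begin

text \<open>
  Let $N$ be the algebra. It has a continuous character \<open>\<theta>\<close> with open kernel, obtained from an open maximal
  ideal because the field is algebraically closed. The elements of $N$ annihilated by \<open>\<theta>\<close> together
  with all their iterated derivatives under the Hamiltonian derivations \<open>\<lambda>g. bracket (a(k := g))\<close> form a
  proper ideal for the product and the bracket, hence they are zero by simplicity: an element of $N$ is determined by its ``Taylor
  coefficients'' at \<open>\<theta>\<close>. Linear compactness (decreasing sequences of nonempty closed affine subspaces
  have nonempty intersection) then makes every element outside the kernel of \<open>\<theta>\<close> invertible, and
  simplicity yields $f_1,\ldots,f_n$ whose bracket $u$ is invertible.
  
  The algebraic heart is the lemma \<open>frame_expansion\<close>. Put
  $\partial_i g = u^{-1}\{f_1,\ldots,g,\ldots,f_n\}$, with $g$ in position $i$. Inserting a product into the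
  Filippov-Jacobi identity leaves a quadratic relation between brackets (\<open>symbol_identity\<close>); applied
  to the $f_i$ and using $n > 2$, it gives $\{c_1,\ldots,g,\ldots,c_n\} = \sum_i \partial_i g\,
  \{c_1,\ldots,f_i,\ldots,c_n\}$. Thus every bracket is $u \det(\partial_j a_i)$, and the $\partial_i$
  commute and satisfy $\partial_i f_j = \delta_{ij}$. For $n = 2$ this fails: a Poisson
  bivector need not be decomposable.
  
  Commuting derivations of this kind, with no proper nonzero ideal stable under all of them, identify
  $N$ with the power series ring through the Taylor map (locale \<open>coordinate_derivations\<close>): it
  is injective by simplicity, surjective by linear compactness, and a homeomorphism by Chevalley's
  theorem on decreasing sequences of closed subspaces. Under this identification the bracket is $u$
  times the Jacobian determinant. Surjectivity also provides $g$ with $\partial_1 g = u^{-1}$, and replacing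
  $f_1$ by $g$ makes $u = 1$; the Taylor map of the new frame is the required isomorphism.
\<close>

section \<open>Subspaces of finite codimension\<close>

locale space_over_field = vector_space smul
  for smul :: "'f::field \<Rightarrow> 'a::ab_group_add \<Rightarrow> 'a"
begin

notation smul (infixr "\<cdot>" 75)

text \<open>
  A subset has finite codimension if finitely many vectors span the whole space modulo it; this is
  applied to subspaces.
\<close>

definition finite_codim :: "'a set \<Rightarrow> bool" where
  "finite_codim U \<longleftrightarrow> (\<exists>B. finite B \<and> (\<forall>x. \<exists>y\<in>span B. x - y \<in> U))"

lemma finite_codim_mono: "finite_codim U \<Longrightarrow> U \<subseteq> W \<Longrightarrow> finite_codim W"
  unfolding finite_codim_def by (meson subsetD)

lemma finite_codim_dependent:
  fixes v :: "nat \<Rightarrow> 'a"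
  assumes U: "finite_codim U" "subspace U"
  obtains d c where "\<exists>k\<le>d. c k \<noteq> 0" "(\<Sum>k\<le>d. c k \<cdot> v k) \<in> U"
proof -
  obtain B where B: "finite B" "\<forall>x. \<exists>y\<in>span B. x - y \<in> U"
    using U(1) unfolding finite_codim_def by blast
  then have "\<forall>x. \<exists>y. y \<in> span B \<and> x - y \<in> U" by (simp add: Bex_def)
  from choice[OF this] obtain f where f: "\<forall>x. f x \<in> span B \<and> x - f x \<in> U" ..
  define y where "y k = f (v k)" for k
  have y: "y k \<in> span B" "v k - y k \<in> U" for k
    using f by (simp_all add: y_def)
  let ?d = "card B"
  have "\<exists>c. (\<exists>k\<le>?d. c k \<noteq> 0) \<and> (\<Sum>k\<le>?d. c k \<cdot> y k) = 0"
  proof (cases "inj_on y {..?d}")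
    case True
    have "dependent (y ` {..?d})"
    proof (rule ccontr)
      assume "\<not> dependent (y ` {..?d})"
      moreover have "y ` {..?d} \<subseteq> span B" by (rule image_subsetI) (rule y(1))
      ultimately have "card (y ` {..?d}) \<le> ?d" using independent_span_bound[OF B(1)] by simp
      with True show False by (simp add: card_image)
    qed
    then have "\<exists>u. (\<exists>w\<in>y ` {..?d}. u w \<noteq> 0) \<and> (\<Sum>w\<in>y ` {..?d}. u w \<cdot> w) = 0"
      by (simp only: dependent_finite[of "y ` {..?d}"] finite_imageI finite_atMost)
    then obtain u where "(\<exists>w\<in>y ` {..?d}. u w \<noteq> 0) \<and> (\<Sum>w\<in>y ` {..?d}. u w \<cdot> w) = 0" ..
    then have u: "\<exists>w\<in>y ` {..?d}. u w \<noteq> 0" "(\<Sum>w\<in>y ` {..?d}. u w \<cdot> w) = 0" by simp_all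
    have "(\<Sum>k\<le>?d. u (y k) \<cdot> y k) = 0"
      using u(2) True by (simp add: sum.reindex)
    moreover have "\<exists>k\<le>?d. u (y k) \<noteq> 0" using u(1) by (simp add: Bex_def)
    ultimately show ?thesis by (intro exI[of _ "\<lambda>k. u (y k)"] conjI)
  next
    case False
    then obtain i j where ij: "i \<le> ?d" "j \<le> ?d" "i \<noteq> j" "y i = y j"
      by (auto simp: inj_on_def)
    define c :: "nat \<Rightarrow> 'f" where "c k = (if k = i then 1 else 0) - (if k = j then 1 else 0)" for k
    have "(\<Sum>k\<le>?d. c k \<cdot> y k) = y i - y j"
    proof -
      have "c k \<cdot> y k = (if k = i then y k else 0) - (if k = j then y k else 0)" for k
        by (simp add: c_def scale_left_diff_distrib)
      then show ?thesis using ij(1,2) by (simp add: sum_subtractf)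
    qed
    moreover have "c i \<noteq> 0" using ij by (simp add: c_def)
    ultimately show ?thesis using ij(1,4) by (intro exI[of _ c] conjI exI[of _ i]) auto
  qed
  then obtain c where "(\<exists>k\<le>?d. c k \<noteq> 0) \<and> (\<Sum>k\<le>?d. c k \<cdot> y k) = 0" ..
  then have c: "\<exists>k\<le>?d. c k \<noteq> 0" "(\<Sum>k\<le>?d. c k \<cdot> y k) = 0" by simp_all
  have "(\<Sum>k\<le>?d. c k \<cdot> v k) = (\<Sum>k\<le>?d. c k \<cdot> (v k - y k))"
    using c(2) by (simp add: scale_right_diff_distrib sum_subtractf)
  also have "\<dots> \<in> U"
    by (intro subspace_sum[OF U(2)] subspace_scale[OF U(2)] y)
  finally show ?thesis by (rule that[OF c(1)])
qed

text \<open>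
  Descending chain condition: a nonempty family of subspaces that contain a fixed subspace of finite
  codimension has a minimal member. A strictly decreasing sequence would provide vectors
  \<open>v k\<close>, each outside all later members, and these are independent modulo the fixed subspace.
\<close>

lemma finite_codim_minimal:
  assumes U: "finite_codim U" "subspace U"
    and D: "\<And>i. i \<in> I \<Longrightarrow> subspace (D i)" "\<And>i. i \<in> I \<Longrightarrow> U \<subseteq> D i" and "I \<noteq> {}"
  obtains i where "i \<in> I" "\<And>j. j \<in> I \<Longrightarrow> D j \<subseteq> D i \<Longrightarrow> D j = D i"
proof -
  have "\<exists>i\<in>I. \<forall>j\<in>I. D j \<subseteq> D i \<longrightarrow> D j = D i"
  proof (rule ccontr)
    assume neg: "\<not> ?thesis"
    have step: "\<exists>j. j \<in> I \<and> D j \<subset> D i" if "i \<in> I" for i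
    proof -
      from neg have "\<forall>i\<in>I. \<exists>j\<in>I. D j \<subseteq> D i \<and> D j \<noteq> D i" by simp
      from this that have "\<exists>j\<in>I. D j \<subseteq> D i \<and> D j \<noteq> D i" by (rule bspec)
      then show ?thesis by (simp add: psubset_eq Bex_def)
    qed
    have "\<exists>s. \<forall>k. s k \<in> I \<and> D (s (Suc k)) \<subset> D (s k)"
      by (rule dependent_nat_choice[of "\<lambda>_ i. i \<in> I" "\<lambda>_ i j. D j \<subset> D i"])
         (use \<open>I \<noteq> {}\<close> step in auto)
    then obtain s where s: "\<And>k. s k \<in> I" "\<And>k. D (s (Suc k)) \<subset> D (s k)" by blast
    have anti: "D (s n) \<subseteq> D (s m)" if "m \<le> n" for m n
      using that
    proof (induction n)
      case (Suc n) then show ?case using s(2)[of n] by (cases "m = Suc n") auto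
    qed simp
    have "\<forall>k. \<exists>v. v \<in> D (s k) - D (s (Suc k))" using s by blast
    then obtain v where v: "\<And>k. v k \<in> D (s k)" "\<And>k. v k \<notin> D (s (Suc k))"
      using choice[of "\<lambda>k v. v \<in> D (s k) - D (s (Suc k))"] by blast
    obtain d c where c: "\<exists>k\<le>d. c k \<noteq> 0" "(\<Sum>k\<le>d. c k \<cdot> v k) \<in> U"
      by (rule finite_codim_dependent[OF U, of v])
    \<comment> \<open>The first nonzero term of the relation lies in the next member of the chain.\<close>
    define m where "m = (LEAST k. c k \<noteq> 0)"
    obtain k0 where k0: "k0 \<le> d" "c k0 \<noteq> 0" using c(1) by blast
    have m1: "c m \<noteq> 0" unfolding m_def using k0(2) by (rule LeastI)
    have m2: "c k = 0" if "k < m" for k using not_less_Least[of k "\<lambda>k. c k \<noteq> 0"] that unfolding m_def by blast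
    have "m \<le> k0" unfolding m_def using k0(2) by (rule Least_le)
    with k0 have m3: "m \<le> d" by simp
    note m = m1 m2 m3
    have sub: "subspace (D (s (Suc m)))" by (rule D(1)[OF s(1)])
    have "c m \<cdot> v m = (\<Sum>k\<le>d. c k \<cdot> v k) - (\<Sum>k\<in>{..d} - {m}. c k \<cdot> v k)"
      using m(3) by (simp add: sum.remove[of "{..d}" m])
    also have "\<dots> \<in> D (s (Suc m))"
    proof (rule subspace_diff[OF sub _ subspace_sum[OF sub]])
      show "(\<Sum>k\<le>d. c k \<cdot> v k) \<in> D (s (Suc m))" by (rule subsetD[OF D(2)[OF s(1)] c(2)])
      fix k assume k: "k \<in> {..d} - {m}"
      show "c k \<cdot> v k \<in> D (s (Suc m))"
      proof (cases "k < m")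
        case True then show ?thesis using m(2) subspace_0[OF sub] by simp
      next
        case False
        then have "v k \<in> D (s (Suc m))" using k v(1) anti[of "Suc m" k] by auto
        then show ?thesis by (rule subspace_scale[OF sub])
      qed
    qed
    finally have "(1 / c m) \<cdot> (c m \<cdot> v m) \<in> D (s (Suc m))" by (rule subspace_scale[OF sub])
    then show False using v(2) m(1) by simp
  qed
  then obtain i where "i \<in> I" and i: "\<forall>j\<in>I. D j \<subseteq> D i \<longrightarrow> D j = D i" ..
  show ?thesis by (rule that[OF \<open>i \<in> I\<close>]) (use i in simp)
qed

end

section \<open>Linearly compact spaces\<close>

text \<open>
  A presentation of the space as a product of finite-dimensional discrete spaces: \<open>p x i\<close> is the
  coordinate of \<open>x\<close> in the factor \<open>V i\<close>, and the topology is the product topology.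
\<close>

locale linear_coordinates = space_over_field smul
  for smul :: "'f::field \<Rightarrow> 'a::ab_group_add \<Rightarrow> 'a" +
  fixes T :: "'a topology" and I :: "'a set" and V :: "'a \<Rightarrow> 'a set" and p :: "'a \<Rightarrow> 'a \<Rightarrow> 'a"
  assumes finite_dim: "i \<in> I \<Longrightarrow> \<exists>B. finite B \<and> V i = span B"
    and lin: "i \<in> I \<Longrightarrow> Vector_Spaces.linear smul smul (\<lambda>x. p x i)"
    and range: "i \<in> I \<Longrightarrow> p x i \<in> V i"
    and separating: "(\<And>i. i \<in> I \<Longrightarrow> p x i = p y i) \<Longrightarrow> x = y"
    and product: "(\<And>i. i \<in> I \<Longrightarrow> v i \<in> V i) \<Longrightarrow> \<exists>x. \<forall>i\<in>I. p x i = v i"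
    and openin_iff: "openin T U \<longleftrightarrow>
      (\<forall>x\<in>U. \<exists>F\<subseteq>I. finite F \<and> (\<forall>y. (\<forall>i\<in>F. p y i = p x i) \<longrightarrow> y \<in> U))"
begin

lemma p_add: "i \<in> I \<Longrightarrow> p (x + y) i = p x i + p y i"
  and p_scale: "i \<in> I \<Longrightarrow> p (c \<cdot> x) i = c \<cdot> p x i"
  using lin[of i] by (simp_all add: Vector_Spaces.linear_iff)

lemma p_0: "i \<in> I \<Longrightarrow> p 0 i = 0"
  using p_scale[of i 0 0] by simp

lemma p_diff: "i \<in> I \<Longrightarrow> p (x - y) i = p x i - p y i"
  using p_add[of i "x - y" y] by (simp add: algebra_simps)

lemma V_subspace: "i \<in> I \<Longrightarrow> subspace (V i)"
  using finite_dim[of i] by auto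

text \<open>
  The subspaces on which finitely many coordinates vanish form a basis of neighbourhoods of zero.
\<close>

definition coord_kernel :: "'a set \<Rightarrow> 'a set" where
  "coord_kernel F = {x. \<forall>i\<in>F. p x i = 0}"

lemma subspace_coord_kernel: "F \<subseteq> I \<Longrightarrow> subspace (coord_kernel F)"
  by (rule subspaceI) (auto simp: coord_kernel_def subset_iff p_0 p_add p_scale)

lemma openin_coord_kernel_translate:
  assumes "F \<subseteq> I" "finite F"
  shows "openin T {y. y - x \<in> coord_kernel F}"
  unfolding openin_iff
proof (intro ballI exI[of _ F] conjI allI impI)
  fix y z assume y: "y \<in> {y. y - x \<in> coord_kernel F}" and z: "\<forall>i\<in>F. p z i = p y i"
  have "p (z - x) i = p (y - x) i" if "i \<in> F" for i
    using that z assms(1) by (simp add: p_diff subset_iff)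
  then show "z \<in> {y. y - x \<in> coord_kernel F}"
    using y by (simp add: coord_kernel_def)
qed (use assms in auto)

lemma coord_section:
  assumes i: "i \<in> I" "w \<in> V i"
  obtains x where "p x i = w" "\<And>j. j \<in> I \<Longrightarrow> j \<noteq> i \<Longrightarrow> p x j = 0"
proof -
  have "\<exists>x. \<forall>j\<in>I. p x j = (if j = i then w else 0)"
    by (rule product) (use i V_subspace subspace_0 in auto)
  then obtain x where x: "\<forall>j\<in>I. p x j = (if j = i then w else 0)" ..
  show ?thesis by (rule that[of x]) (use x i in simp_all)
qed

text \<open>
  By induction on the set of coordinates: the coordinate \<open>i\<close> of a vector is corrected by a section
  \<open>s\<close> of \<open>\<lambda>x. p x i\<close> on the finite-dimensional space \<open>V i\<close>, which leaves the other coordinates unchanged.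
\<close>

lemma finite_codim_coord_kernel:
  assumes "finite F" "F \<subseteq> I"
  shows "finite_codim (coord_kernel F)"
  using assms
proof (induction F)
  case empty
  have "\<forall>x. \<exists>y\<in>span {}. x - y \<in> coord_kernel {}" by (simp add: coord_kernel_def)
  then show ?case unfolding finite_codim_def by blast
next
  case (insert i F)
  then have i: "i \<in> I" by simp
  obtain B where B: "finite B" "\<forall>x. \<exists>y\<in>span B. x - y \<in> coord_kernel F"
    using insert unfolding finite_codim_def by auto
  obtain C where C: "finite C" "V i = span C" using finite_dim[OF i] by (elim exE conjE)
  have "\<forall>w. \<exists>x. w \<in> V i \<longrightarrow> p x i = w \<and> (\<forall>j\<in>I. j \<noteq> i \<longrightarrow> p x j = 0)"
    using coord_section[OF i] by metis
  from choice[OF this] obtain s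
    where s: "\<forall>w. w \<in> V i \<longrightarrow> p (s w) i = w \<and> (\<forall>j\<in>I. j \<noteq> i \<longrightarrow> p (s w) j = 0)" ..
  have s_add: "s (w + w') = s w + s w'" if "w \<in> V i" "w' \<in> V i" for w w'
  proof (rule separating)
    fix j assume "j \<in> I"
    then show "p (s (w + w')) j = p (s w + s w') j"
      using s that subspace_add[OF V_subspace[OF i] that] by (cases "j = i") (auto simp: p_add)
  qed
  have s_scale: "s (c \<cdot> w) = c \<cdot> s w" if "w \<in> V i" for c w
  proof (rule separating)
    fix j assume "j \<in> I"
    then show "p (s (c \<cdot> w)) j = p (c \<cdot> s w) j"
      using s that subspace_scale[OF V_subspace[OF i] that] by (cases "j = i") (auto simp: p_scale)
  qed
  have 0: "0 \<in> V i" using subspace_0[OF V_subspace[OF i]] .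
  have "subspace {w \<in> V i. s w \<in> span (s ` C)}"
  proof (rule subspaceI)
    have "s 0 = 0" using s_scale[OF 0, of 0] by simp
    then show "0 \<in> {w \<in> V i. s w \<in> span (s ` C)}" using 0 by (simp add: span_zero)
  qed (use V_subspace[OF i] in \<open>auto simp: s_add s_scale subspace_add subspace_scale span_add span_scale\<close>)
  moreover have "C \<subseteq> {w \<in> V i. s w \<in> span (s ` C)}"
    unfolding C(2) by (auto intro: span_base)
  ultimately have "span C \<subseteq> {w \<in> V i. s w \<in> span (s ` C)}" by (rule span_minimal[rotated])
  then have s_span: "s w \<in> span (s ` C)" if "w \<in> V i" for w using that C(2) by blast
  have "\<exists>y\<in>span (B \<union> s ` C). x - y \<in> coord_kernel (insert i F)" for x
  proof -
    obtain y where y: "y \<in> span B" "x - y \<in> coord_kernel F" using B(2) by blast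
    define w where "w = p (x - y) i"
    have w: "w \<in> V i" unfolding w_def by (rule range[OF i])
    have "p (x - (y + s w)) j = 0" if "j \<in> insert i F" for j
    proof -
      have j: "j \<in> I" using that insert.prems by auto
      have "p (x - (y + s w)) j = p (x - y) j - p (s w) j"
        using j by (simp add: p_diff p_add)
      also have "\<dots> = 0"
        using that y(2) s w j by (cases "j = i") (auto simp: w_def coord_kernel_def)
      finally show ?thesis .
    qed
    moreover have "y + s w \<in> span (B \<union> s ` C)"
      using y(1) s_span[OF w] span_mono[of B "B \<union> s ` C"] span_mono[of "s ` C" "B \<union> s ` C"]
      by (intro span_add) auto
    ultimately show ?thesis unfolding coord_kernel_def by blast
  qed
  moreover have "finite (B \<union> s ` C)" using B C by simp
  ultimately show ?case unfolding finite_codim_def by blast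
qed

lemma openin_nbhd_subspace:
  assumes "openin T U" "x \<in> U"
  obtains F where "F \<subseteq> I" "finite F" "\<forall>y. y - x \<in> coord_kernel F \<longrightarrow> y \<in> U"
proof -
  obtain F where F: "F \<subseteq> I" "finite F" "\<forall>y. (\<forall>i\<in>F. p y i = p x i) \<longrightarrow> y \<in> U"
    using assms unfolding openin_iff by blast
  have "y \<in> U" if "y - x \<in> coord_kernel F" for y
  proof -
    have "p y i = p x i" if "i \<in> F" for i
      using that \<open>y - x \<in> coord_kernel F\<close> F(1) p_diff[of i y x] by (auto simp: coord_kernel_def)
    then show ?thesis using F(3) by blast
  qed
  then show ?thesis by (intro that[OF F(1,2)]) simp
qed

text \<open>
  Compactness for decreasing sequences of nonempty closed affine subspaces \<open>A k\<close>, the direction of \<open>A k\<close>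
  being \<open>W k\<close>. A set of prescriptions ``coordinate \<open>i\<close> has value \<open>v\<close>'' is consistent if any
  finitely many of them can be met inside each \<open>A k\<close>. A maximal consistent set prescribes every coordinate,
  by the descending chain condition in the finite-dimensional space \<open>V i\<close>; the point that
  it defines is in the closure of each \<open>A k\<close>.
\<close>

lemma closed_affine_inter:
  fixes A :: "nat \<Rightarrow> 'a set"
  assumes closed: "\<And>k. closedin T (A k)" and dec: "\<And>k. A (Suc k) \<subseteq> A k"
    and ne: "\<And>k. A k \<noteq> {}"
    and W: "\<And>k. subspace (W k)" and affine: "\<And>k x y. x \<in> A k \<Longrightarrow> y \<in> A k \<longleftrightarrow> y - x \<in> W k"
  shows "\<exists>x. \<forall>k. x \<in> A k"
proof -
  have anti: "A n \<subseteq> A m" if "m \<le> n" for m n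
    using that
  proof (induction n)
    case (Suc n) then show ?case using dec[of n] by (cases "m = Suc n") auto
  qed simp
  have W_anti: "W n \<subseteq> W m" if "m \<le> n" for m n
  proof
    fix w assume w: "w \<in> W n"
    obtain x where x: "x \<in> A n" using ne[of n] by blast
    have "x + w \<in> A n" using affine[OF x] w by simp
    then have "x \<in> A m" "x + w \<in> A m" using x anti[OF that] by blast+
    then show "w \<in> W m" using affine[of x m "x + w"] by simp
  qed
  define consistent where "consistent G \<longleftrightarrow>
    G \<subseteq> I \<times> UNIV \<and> (\<forall>k F. F \<subseteq> G \<longrightarrow> finite F \<longrightarrow> (\<exists>y\<in>A k. \<forall>(i, v)\<in>F. p y i = v))" for G
  have "\<exists>G\<in>Collect consistent. \<forall>G'\<in>Collect consistent. G \<subseteq> G' \<longrightarrow> G' = G"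
  proof (rule subset_Zorn_nonempty)
    have "consistent {}" using ne by (auto simp: consistent_def)
    then show "Collect consistent \<noteq> {}" by blast
    fix C assume C: "C \<noteq> {}" "subset.chain (Collect consistent) C"
    then have Cc: "\<And>G. G \<in> C \<Longrightarrow> consistent G" by (auto simp: subset.chain_def)
    have "\<exists>y\<in>A k. \<forall>(i, v)\<in>F. p y i = v" if F: "F \<subseteq> \<Union>C" "finite F" for F k
    proof -
      obtain G where "G \<in> C" "F \<subseteq> G"
        using finite_subset_Union_chain[OF F(2,1) C(1)] C(2) by blast
      then show ?thesis using Cc F(2) unfolding consistent_def by blast
    qed
    moreover have "\<Union>C \<subseteq> I \<times> UNIV" using Cc by (auto simp: consistent_def)
    ultimately show "\<Union>C \<in> Collect consistent" by (simp add: consistent_def)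
  qed
  then obtain G where G: "consistent G" and max: "\<And>G'. consistent G' \<Longrightarrow> G \<subseteq> G' \<Longrightarrow> G' = G"
    by auto
  have GI: "G \<subseteq> I \<times> UNIV" using G by (simp add: consistent_def)
  have ex: "\<exists>y\<in>A k. \<forall>(i, v)\<in>F. p y i = v" if "F \<subseteq> G" "finite F" for F k
    using G that unfolding consistent_def by blast
  have total: "\<exists>v. (i, v) \<in> G" if i: "i \<in> I" for i
  proof -
    \<comment> \<open>\<open>D (k, F)\<close> is the direction of the image in \<open>V i\<close> of the points of \<open>A k\<close> that meet the
      prescriptions \<open>F\<close>, pulled back to the whole space; a minimal one is contained in all others.\<close>
    define Q where "Q = {(k :: nat, F). F \<subseteq> G \<and> finite F}"
    define D where "D q = {w + z | w z. w \<in> W (fst q) \<inter> coord_kernel (fst ` snd q) \<and> z \<in> coord_kernel {i}}" for q :: "nat \<times> ('a \<times> 'a) set"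
    have ker: "subspace (coord_kernel {i})" using i by (intro subspace_coord_kernel) simp
    have sub: "subspace (W (fst q) \<inter> coord_kernel (fst ` snd q))" if "q \<in> Q" for q
    proof -
      have "fst ` snd q \<subseteq> I" using that GI by (force simp: Q_def)
      then show ?thesis by (intro subspace_inter W subspace_coord_kernel)
    qed
    obtain q0 where q0: "q0 \<in> Q" "\<And>q. q \<in> Q \<Longrightarrow> D q \<subseteq> D q0 \<Longrightarrow> D q = D q0"
    proof (rule finite_codim_minimal[of "coord_kernel {i}" Q D])
      show "finite_codim (coord_kernel {i})" using i by (intro finite_codim_coord_kernel) auto
      show "subspace (coord_kernel {i})" by (rule ker)
      show "subspace (D q)" if "q \<in> Q" for q
        unfolding D_def by (rule subspace_sums[OF sub[OF that] ker])
      show "coord_kernel {i} \<subseteq> D q" if "q \<in> Q" for q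
      proof
        fix z assume "z \<in> coord_kernel {i}"
        moreover have "0 \<in> W (fst q) \<inter> coord_kernel (fst ` snd q)" using sub[OF that] by (rule subspace_0)
        ultimately show "z \<in> D q" unfolding D_def by (intro CollectI exI[of _ 0] exI[of _ z]) simp
      qed
      have "(0, {}) \<in> Q" by (simp add: Q_def)
      then show "Q \<noteq> {}" by blast
    qed (rule that)
    obtain k0 F0 where q0_eq: "q0 = (k0, F0)" by (cases q0)
    have F0: "F0 \<subseteq> G" "finite F0" using q0(1) by (auto simp: q0_eq Q_def)
    obtain y0 where y0: "y0 \<in> A k0" "\<forall>(j, v)\<in>F0. p y0 j = v" using ex[OF F0] by blast
    define v where "v = p y0 i"
    have "consistent (insert (i, v) G)"
      unfolding consistent_def
    proof (intro conjI allI impI)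
      show "insert (i, v) G \<subseteq> I \<times> UNIV" using GI i by simp
      fix k F assume F: "F \<subseteq> insert (i, v) G" "finite F"
      define k1 where "k1 = max k k0"
      define F1 where "F1 = (F - {(i, v)}) \<union> F0"
      have F1: "F1 \<subseteq> G" "finite F1" using F F0 by (auto simp: F1_def)
      have q1: "(k1, F1) \<in> Q" using F1 by (simp add: Q_def)
      have "D (k1, F1) \<subseteq> D q0"
      proof -
        have "W k1 \<subseteq> W k0" by (rule W_anti) (simp add: k1_def)
        moreover have "coord_kernel (fst ` F1) \<subseteq> coord_kernel (fst ` F0)"
          by (auto simp: F1_def coord_kernel_def)
        ultimately have sub: "W k1 \<inter> coord_kernel (fst ` F1) \<subseteq> W k0 \<inter> coord_kernel (fst ` F0)" by (rule Int_mono)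
        show ?thesis
        proof
          fix d assume "d \<in> D (k1, F1)"
          then obtain w z where "d = w + z" "w \<in> W k1 \<inter> coord_kernel (fst ` F1)" "z \<in> coord_kernel {i}"
            unfolding D_def fst_conv snd_conv mem_Collect_eq by (elim exE conjE)
          then show "d \<in> D q0"
            unfolding D_def q0_eq fst_conv snd_conv mem_Collect_eq using sub
            by (intro exI[of _ w] exI[of _ z] conjI) auto
        qed
      qed
      then have D_eq: "D (k1, F1) = D q0" by (rule q0(2)[OF q1])
      obtain y1 where y1: "y1 \<in> A k1" "\<forall>(j, v)\<in>F1. p y1 j = v" using ex[OF F1] by blast
      have "y1 - y0 \<in> W k0"
        using affine[OF y0(1), of y1] y1(1) anti[of k0 k1] by (auto simp: k1_def)
      moreover have "y1 - y0 \<in> coord_kernel (fst ` F0)"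
        unfolding coord_kernel_def
      proof (intro CollectI ballI)
        fix j assume "j \<in> fst ` F0"
        then obtain u where u: "(j, u) \<in> F0" by auto
        then have "j \<in> I" "(j, u) \<in> F1" using F0(1) GI by (auto simp: F1_def)
        then show "p (y1 - y0) j = 0" using u y0(2) y1(2) by (auto simp: p_diff)
      qed
      ultimately have "y1 - y0 \<in> D (k1, F1)"
        unfolding D_eq
        unfolding D_def q0_eq using subspace_0[OF ker]
        by (intro CollectI exI[of _ "y1 - y0"] exI[of _ 0]) simp
      then obtain w z where wz: "y1 - y0 = w + z" "w \<in> W k1" "w \<in> coord_kernel (fst ` F1)" "z \<in> coord_kernel {i}"
        unfolding D_def by auto
      define y where "y = y1 - w"
      have "y \<in> A k1"
        using affine[OF y1(1), of y] subspace_neg[OF W wz(2)] by (simp add: y_def)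
      then have "y \<in> A k" using anti[of k k1] by (auto simp: k1_def)
      moreover have "p y j = u" if ju: "(j, u) \<in> F" for j u
      proof (cases "(j, u) = (i, v)")
        case True
        have "y = y0 + z" using wz(1) by (simp add: y_def algebra_simps)
        then show ?thesis using True wz(4) i by (simp add: p_add coord_kernel_def v_def)
      next
        case False
        then have F1j: "(j, u) \<in> F1" using ju by (simp add: F1_def)
        then have "j \<in> I" using F1(1) GI by auto
        moreover have "p w j = 0" using wz(3) F1j by (force simp: coord_kernel_def)
        ultimately show ?thesis using y1(2) F1j by (auto simp: y_def p_diff)
      qed
      ultimately show "\<exists>y\<in>A k. \<forall>(i, v)\<in>F. p y i = v" by blast
    qed
    then have "insert (i, v) G = G" by (rule max) auto
    then show ?thesis by blast
  qed
  have "\<forall>i. \<exists>v. i \<in> I \<longrightarrow> (i, v) \<in> G" using total by blast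
  from choice[OF this] obtain v where v: "\<forall>i. i \<in> I \<longrightarrow> (i, v i) \<in> G" ..
  have "\<exists>x. \<forall>i\<in>I. p x i = v i"
  proof (rule product)
    fix i assume i: "i \<in> I"
    then have "{(i, v i)} \<subseteq> G" using v by blast
    from ex[OF this] obtain y where "p y i = v i" by auto
    then show "v i \<in> V i" using range[OF i, of y] by simp
  qed
  then obtain x where x: "\<forall>i\<in>I. p x i = v i" ..
  have "x \<in> A k" for k
  proof (rule ccontr)
    assume "x \<notin> A k"
    have "openin T (topspace T - A k)" using closed[of k] by blast
    moreover have "topspace T = UNIV"
      using openin_subset[of T UNIV] by (auto simp: openin_iff)
    ultimately have "openin T (topspace T - A k)" "x \<in> topspace T - A k" using \<open>x \<notin> A k\<close> by auto
    then obtain F where F: "F \<subseteq> I" "finite F" "\<forall>y. y - x \<in> coord_kernel F \<longrightarrow> y \<in> topspace T - A k"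
      by (rule openin_nbhd_subspace)
    have "(\<lambda>i. (i, v i)) ` F \<subseteq> G" using v F(1) by blast
    from ex[OF this] F(2) obtain y where y: "y \<in> A k" "\<forall>i\<in>F. p y i = v i" by auto
    have "y - x \<in> coord_kernel F" using y(2) x F(1) by (auto simp: coord_kernel_def p_diff subset_iff)
    then show False using F(3) y(1) by blast
  qed
  then show ?thesis by blast
qed

end

text \<open>
  Spaces with a linearly compact topology. The facts of the previous locale are restated below without
  reference to a choice of coordinates.
\<close>

locale linearly_compact_space = space_over_field smul
  for smul :: "'f::field \<Rightarrow> 'a::ab_group_add \<Rightarrow> 'a" +
  fixes T :: "'a topology"
  assumes linearly_compact: "linearly_compact T"
begin

lemma coordinates:
  obtains I V p where "linear_coordinates smul T I V p"
proof -
  obtain I :: "'a set" and V p where top: "topspace T = UNIV"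
    and V: "\<forall>i\<in>I. \<exists>B. finite B \<and> V i = span B"
    and lin: "\<forall>i\<in>I. Vector_Spaces.linear smul smul (\<lambda>x. p x i)"
    and hom: "homeomorphic_map T (product_topology (\<lambda>i. discrete_topology (V i)) I) p"
    using linearly_compact unfolding linearly_compact_def by blast
  let ?P = "product_topology (\<lambda>i. discrete_topology (V i)) I"
  have inj: "inj p" and img: "range p = PiE I V"
    using homeomorphic_imp_injective_map[OF hom] homeomorphic_imp_surjective_map[OF hom] top
    by auto
  have pV: "p x i \<in> V i" if "i \<in> I" for x i
    using img that by (metis PiE_mem rangeI)
  have inj': "x = y" if "\<And>i. i \<in> I \<Longrightarrow> p x i = p y i" for x y
  proof -
    have "p x \<in> PiE I V" "p y \<in> PiE I V" using img by auto
    then have "p x = p y" by (rule PiE_ext) (use that in auto)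
    then show ?thesis using inj by (simp add: inj_eq)
  qed
  have surj: "\<exists>x. \<forall>i\<in>I. p x i = v i" if "\<And>i. i \<in> I \<Longrightarrow> v i \<in> V i" for v
  proof -
    have "restrict v I \<in> range p" using that unfolding img by auto
    then obtain x where "restrict v I = p x" by blast
    then have "\<forall>i\<in>I. p x i = v i" by (metis restrict_apply')
    then show ?thesis ..
  qed
  have op: "openin T U \<longleftrightarrow> (\<forall>x\<in>U. \<exists>F\<subseteq>I. finite F \<and> (\<forall>y. (\<forall>i\<in>F. p y i = p x i) \<longrightarrow> y \<in> U))" for U
  proof -
    have "openin T U \<longleftrightarrow> openin ?P (p ` U)"
      using homeomorphic_map_openness_eq[OF hom, of U] top by (simp add: openin_subset)
    also have "\<dots> \<longleftrightarrow> (\<forall>x\<in>p ` U. \<exists>W. finite {i \<in> I. W i \<noteq> V i} \<and> (\<forall>i\<in>I. W i \<subseteq> V i) \<and> x \<in> PiE I W \<and> PiE I W \<subseteq> p ` U)"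
      by (simp add: openin_product_topology_alt)
    also have "\<dots> \<longleftrightarrow> (\<forall>x\<in>U. \<exists>F\<subseteq>I. finite F \<and> (\<forall>y. (\<forall>i\<in>F. p y i = p x i) \<longrightarrow> y \<in> U))"
      (is "(\<forall>x\<in>p ` U. ?L x) \<longleftrightarrow> (\<forall>x\<in>U. ?R x)")
    proof -
      have "?L (p x) \<longleftrightarrow> ?R x" for x
      proof
        assume "?L (p x)"
        then obtain W where W: "finite {i \<in> I. W i \<noteq> V i}" "p x \<in> PiE I W" "PiE I W \<subseteq> p ` U" by (elim exE conjE)
        have "y \<in> U" if y: "\<forall>i\<in>{i \<in> I. W i \<noteq> V i}. p y i = p x i" for y
        proof -
          have "p y \<in> PiE I V" using img by auto
          moreover have "p y i \<in> W i" if "i \<in> I" for i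
            using that y W(2) pV[OF that, of y] by (cases "W i = V i") (auto simp: PiE_iff)
          ultimately have "p y \<in> PiE I W" by (auto simp: PiE_iff)
          then have "p y \<in> p ` U" using W(3) by blast
          then show ?thesis using inj by (auto simp: inj_eq)
        qed
        then show "?R x" using W(1) by (intro exI[of _ "{i \<in> I. W i \<noteq> V i}"]) auto
      next
        assume "?R x"
        then obtain F where F0: "F \<subseteq> I \<and> finite F \<and> (\<forall>y. (\<forall>i\<in>F. p y i = p x i) \<longrightarrow> y \<in> U)" ..
        then have F: "F \<subseteq> I" "finite F" "\<And>y. (\<forall>i\<in>F. p y i = p x i) \<Longrightarrow> y \<in> U" by blast+
        define W where "W i = (if i \<in> F then {p x i} else V i)" for i
        have "p x \<in> PiE I V" using img by auto
        then have "p x \<in> PiE I W" by (auto simp: PiE_iff W_def)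
        moreover have "finite {i \<in> I. W i \<noteq> V i}"
          by (rule finite_subset[OF _ F(2)]) (auto simp: W_def)
        moreover have "\<forall>i\<in>I. W i \<subseteq> V i" using pV by (auto simp: W_def)
        moreover have "PiE I W \<subseteq> p ` U"
        proof
          fix z assume z: "z \<in> PiE I W"
          then have "z \<in> PiE I V" using \<open>\<forall>i\<in>I. W i \<subseteq> V i\<close> by (auto simp: PiE_iff)
          then obtain y where y: "z = p y" using img by blast
          have "p y i = p x i" if "i \<in> F" for i
          proof -
            have "p y i \<in> W i" using z y F(1) that by (auto simp: PiE_iff)
            then show ?thesis using that by (simp add: W_def)
          qed
          then have "y \<in> U" by (intro F(3)) blast
          then show "z \<in> p ` U" using y by blast
        qed
        ultimately show "?L (p x)" by (intro exI[of _ W] conjI)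
      qed
      then have eq: "\<And>x. ?L (p x) = ?R x" .
      show ?thesis unfolding ball_simps(9) by (rule ball_cong[OF refl eq])
    qed
    finally show ?thesis .
  qed
  have "linear_coordinates smul T I V p"
  proof (rule linear_coordinates.intro[OF space_over_field_axioms], rule linear_coordinates_axioms.intro, goal_cases)
    case (1 i) then show ?case using V by simp
  next
    case (2 i) then show ?case using lin by simp
  next
    case (3 i x) then show ?case by (rule pV)
  next
    case (4 x y) then show ?case by (rule inj')
  next
    case (5 v) then show ?case by (rule surj)
  next
    case (6 U) then show ?case by (rule op)
  qed
  then show ?thesis by (rule that)
qed

lemma topspace_T [simp]: "topspace T = UNIV"
  using linearly_compact by (auto simp: linearly_compact_def)

end

context linearly_compact_space
begin

lemma finite_codim_open_subspace:
  assumes "openin T U" "subspace U"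
  shows "finite_codim U"
proof -
  obtain I V p where "linear_coordinates smul T I V p" by (rule coordinates)
  then interpret linear_coordinates smul T I V p .
  obtain F where F: "F \<subseteq> I" "finite F" "\<forall>y. y - 0 \<in> coord_kernel F \<longrightarrow> y \<in> U"
    by (rule openin_nbhd_subspace[OF assms(1) subspace_0[OF assms(2)]])
  show ?thesis
    by (rule finite_codim_mono[OF finite_codim_coord_kernel[OF F(2,1)]]) (use F(3) in auto)
qed

lemma openin_nbhd:
  assumes "openin T U" "x \<in> U"
  obtains W where "subspace W" "openin T W" "\<forall>y. y - x \<in> W \<longrightarrow> y \<in> U"
proof -
  obtain I V p where "linear_coordinates smul T I V p" by (rule coordinates)
  then interpret linear_coordinates smul T I V p .
  obtain F where F: "F \<subseteq> I" "finite F" "\<forall>y. y - x \<in> coord_kernel F \<longrightarrow> y \<in> U"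
    by (rule openin_nbhd_subspace[OF assms])
  show ?thesis
    by (rule that[OF subspace_coord_kernel[OF F(1)] _ F(3)])
       (use openin_coord_kernel_translate[OF F(1,2), of 0] in simp_all)
qed

lemma openin_translate:
  assumes U: "openin T U"
  shows "openin T {y. y - a \<in> U}"
proof -
  obtain I V p where "linear_coordinates smul T I V p" by (rule coordinates)
  then interpret linear_coordinates smul T I V p .
  show ?thesis
  proof (subst openin_subopen, intro ballI)
    fix x assume "x \<in> {y. y - a \<in> U}"
    then have "x - a \<in> U" by simp
    then obtain F where F: "F \<subseteq> I" "finite F" "\<forall>y. y - (x - a) \<in> coord_kernel F \<longrightarrow> y \<in> U"
      by (rule openin_nbhd_subspace[OF U])
    let ?S = "{y. y - x \<in> coord_kernel F}"
    have "openin T ?S" by (rule openin_coord_kernel_translate[OF F(1,2)])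
    moreover have "x \<in> ?S" using F(1) by (simp add: subspace_0[OF subspace_coord_kernel])
    moreover have "?S \<subseteq> {y. y - a \<in> U}"
    proof
      fix y assume "y \<in> ?S"
      then have "(y - a) - (x - a) \<in> coord_kernel F" by simp
      then show "y \<in> {y. y - a \<in> U}" using F(3) by blast
    qed
    ultimately show "\<exists>S. openin T S \<and> x \<in> S \<and> S \<subseteq> {y. y - a \<in> U}" by (intro exI[of _ ?S] conjI)
  qed
qed

lemma closedin_translate:
  assumes "closedin T C"
  shows "closedin T {y. y - a \<in> C}"
proof -
  have "openin T {y. y - a \<in> - C}"
    using assms by (intro openin_translate) (simp add: closedin_def Compl_eq_Diff_UNIV)
  moreover have "{y. y - a \<in> - C} = UNIV - {y. y - a \<in> C}" by blast
  ultimately show ?thesis by (simp add: closedin_def)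
qed

lemma openin_superspace:
  assumes "openin T U" "U \<subseteq> W" "subspace U" "subspace W"
  shows "openin T W"
proof (subst openin_subopen, intro ballI)
  fix x assume x: "x \<in> W"
  let ?S = "{y. y - x \<in> U}"
  have "openin T ?S" by (rule openin_translate[OF assms(1)])
  moreover have "x \<in> ?S" using assms(3) by (simp add: subspace_0)
  moreover have "?S \<subseteq> W"
  proof
    fix y assume "y \<in> ?S"
    then have "(y - x) + x \<in> W" using assms(2) x by (intro subspace_add[OF assms(4)]) auto
    then show "y \<in> W" by simp
  qed
  ultimately show "\<exists>S. openin T S \<and> x \<in> S \<and> S \<subseteq> W" by (intro exI[of _ ?S] conjI)
qed

lemma closedin_open_subspace:
  assumes "openin T U" "subspace U"
  shows "closedin T U"
proof -
  have "openin T (UNIV - U)"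
  proof (subst openin_subopen, intro ballI)
    fix x assume x: "x \<in> UNIV - U"
    let ?S = "{y. y - x \<in> U}"
    have "openin T ?S" by (rule openin_translate[OF assms(1)])
    moreover have "x \<in> ?S" using assms(2) by (simp add: subspace_0)
    moreover have "?S \<subseteq> UNIV - U"
    proof
      fix y assume y: "y \<in> ?S"
      have "y \<notin> U"
      proof
        assume "y \<in> U"
        from subspace_diff[OF assms(2) this, of "y - x"] y have "x \<in> U" by simp
        then show False using x by simp
      qed
      then show "y \<in> UNIV - U" by simp
    qed
    ultimately show "\<exists>S. openin T S \<and> x \<in> S \<and> S \<subseteq> UNIV - U" by (intro exI[of _ ?S] conjI)
  qed
  then show ?thesis by (simp add: closedin_def)
qed

lemma separating_open_subspace:
  assumes "x \<noteq> 0"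
  obtains U where "subspace U" "openin T U" "x \<notin> U"
proof -
  obtain I V p where "linear_coordinates smul T I V p" by (rule coordinates)
  then interpret linear_coordinates smul T I V p .
  have "\<exists>i\<in>I. p x i \<noteq> p 0 i" using separating[of x 0] assms by blast
  then obtain i where i: "i \<in> I" "p x i \<noteq> 0" using p_0 by auto
  show ?thesis
    by (rule that[of "coord_kernel {i}"])
       (use i openin_coord_kernel_translate[of "{i}" 0] subspace_coord_kernel[of "{i}"]
        in \<open>auto simp: coord_kernel_def\<close>)
qed

lemma decreasing_closed_affine_inter:
  fixes A :: "nat \<Rightarrow> 'a set"
  assumes "\<And>k. closedin T (A k)" "\<And>k. A (Suc k) \<subseteq> A k" "\<And>k. A k \<noteq> {}"
    and "\<And>k. subspace (W k)" "\<And>k x y. x \<in> A k \<Longrightarrow> y \<in> A k \<longleftrightarrow> y - x \<in> W k"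
  obtains x where "\<And>k. x \<in> A k"
proof -
  obtain I V p where "linear_coordinates smul T I V p" by (rule coordinates)
  then interpret linear_coordinates smul T I V p .
  have "\<exists>x. \<forall>k. x \<in> A k" by (rule closed_affine_inter[of A W]) (fact assms)+
  then obtain x where "\<forall>k. x \<in> A k" ..
  then show ?thesis by (intro that) blast
qed

text \<open>
  Chevalley's theorem: a decreasing sequence of closed subspaces with zero intersection is eventually
  contained in any given open subspace \<open>J\<close>. The images modulo \<open>J\<close> stabilize, so a vector \<open>v\<close> in the
  stable member but outside \<open>J\<close> is congruent modulo \<open>J\<close> to vectors of all members, hence, by
  compactness, to a vector of the intersection.
\<close>

lemma chevalley:
  fixes W :: "nat \<Rightarrow> 'a set"
  assumes W: "\<And>k. closedin T (W k)" "\<And>k. subspace (W k)" "\<And>k. W (Suc k) \<subseteq> W k"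
    and inter: "\<And>x. (\<And>k. x \<in> W k) \<Longrightarrow> x = 0"
    and J: "openin T J" "subspace J"
  obtains k where "W k \<subseteq> J"
proof -
  have anti: "W n \<subseteq> W m" if "m \<le> n" for m n
    using that
  proof (induction n)
    case (Suc n) then show ?case using W(3)[of n] by (cases "m = Suc n") auto
  qed simp
  define D where "D k = {w + z | w z. w \<in> W k \<and> z \<in> J}" for k
  obtain k0 where k0: "\<And>k. D k \<subseteq> D k0 \<Longrightarrow> D k = D k0"
  proof (rule finite_codim_minimal[of J UNIV D])
    show "subspace (D k)" for k unfolding D_def by (rule subspace_sums[OF W(2) J(2)])
    show "J \<subseteq> D k" for k
    proof
      fix z assume "z \<in> J"
      then show "z \<in> D k" unfolding D_def using subspace_0[OF W(2)]
        by (intro CollectI exI[of _ 0] exI[of _ z]) simp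
    qed
  qed (use J finite_codim_open_subspace in auto)
  have "W k0 \<subseteq> J"
  proof (rule ccontr)
    assume "\<not> W k0 \<subseteq> J"
    then obtain v where v: "v \<in> W k0" "v \<notin> J" by blast
    define A where "A k = W (k0 + k) \<inter> {y. y - v \<in> J}" for k
    obtain x where x: "\<And>k. x \<in> A k"
    proof (rule decreasing_closed_affine_inter[of A "\<lambda>k. W (k0 + k) \<inter> J"])
      show "closedin T (A k)" for k
        unfolding A_def by (intro closedin_Int W(1) closedin_translate closedin_open_subspace J)
      show "A (Suc k) \<subseteq> A k" for k using W(3)[of "k0 + k"] by (auto simp: A_def)
      show "subspace (W (k0 + k) \<inter> J)" for k by (intro subspace_inter W J)
      show "A k \<noteq> {}" for k
      proof -
        have "D (k0 + k) \<subseteq> D k0"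
        proof
          fix d assume "d \<in> D (k0 + k)"
          then obtain w z where "d = w + z" "w \<in> W (k0 + k)" "z \<in> J"
            unfolding D_def mem_Collect_eq by (elim exE conjE)
          then show "d \<in> D k0" unfolding D_def using anti[of k0 "k0 + k"]
            by (intro CollectI exI[of _ w] exI[of _ z]) auto
        qed
        then have "D (k0 + k) = D k0" by (rule k0)
        moreover have "v \<in> D k0" unfolding D_def using v(1) subspace_0[OF J(2)]
          by (intro CollectI exI[of _ v] exI[of _ 0]) simp
        ultimately have "v \<in> D (k0 + k)" by simp
        then obtain w z where wz: "v = w + z" "w \<in> W (k0 + k)" "z \<in> J"
          unfolding D_def mem_Collect_eq by (elim exE conjE)
        have "w - v \<in> J" using wz(1) subspace_neg[OF J(2) wz(3)] by simp
        then have "w \<in> A k" using wz(2) by (simp add: A_def)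
        then show ?thesis by blast
      qed
      show "y \<in> A k \<longleftrightarrow> y - x \<in> W (k0 + k) \<inter> J" if "x \<in> A k" for k x y
      proof
        assume "y \<in> A k"
        then have "y - x \<in> W (k0 + k)" "(y - v) - (x - v) \<in> J"
          using that subspace_diff[OF W(2)] subspace_diff[OF J(2)] unfolding A_def by blast+
        then show "y - x \<in> W (k0 + k) \<inter> J" by simp
      next
        assume "y - x \<in> W (k0 + k) \<inter> J"
        then have "(y - x) + x \<in> W (k0 + k)" "(y - x) + (x - v) \<in> J"
          using that subspace_add[OF W(2)] subspace_add[OF J(2)] unfolding A_def by blast+
        then show "y \<in> A k" by (simp add: A_def)
      qed
    qed (rule that)
    have "x \<in> W k" for k using x[of k] anti[of k "k0 + k"] by (auto simp: A_def)
    then have "x = 0" by (rule inter)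
    then have "- v \<in> J" using x[of 0] by (simp add: A_def)
    then show False using v(2) subspace_neg[OF J(2)] by force
  qed
  then show ?thesis by (rule that)
qed

end

section \<open>Linearly compact commutative algebras\<close>

locale linearly_compact_algebra = linearly_compact_space smul T
  for smul :: "'f::field \<Rightarrow> 'a::comm_ring_1 \<Rightarrow> 'a" and T +
  assumes smul_mult: "smul c (x * y) = smul c x * y"
    and continuous_mult: "continuous_map (prod_topology T T) T (\<lambda>(x, y). x * y)"
begin

text \<open>Ideals for the product only; the bracket plays no role.\<close>

definition alg_ideal :: "'a set \<Rightarrow> bool" where
  "alg_ideal J \<longleftrightarrow> subspace J \<and> (\<forall>x\<in>J. \<forall>y. y * x \<in> J)"

lemma smul_mult_right: "c \<cdot> (x * y) = x * (c \<cdot> y)"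
  using smul_mult[of c y x] by (simp add: mult.commute)

text \<open>
  Open ideals form a basis of neighbourhoods of zero: the elements whose multiples all lie in \<open>U\<close>
  form an ideal, which is open by continuity of the product at the points \<open>(0, y)\<close>, for \<open>y\<close> in a
  finite set spanning the algebra modulo a neighbourhood of zero.
\<close>

lemma open_ideal_below:
  assumes U: "openin T U" "subspace U"
  obtains J where "alg_ideal J" "openin T J" "J \<subseteq> U"
proof -
  have "\<exists>Q. subspace (fst Q) \<and> openin T (fst Q) \<and> subspace (snd Q) \<and> openin T (snd Q) \<and>
      (\<forall>v\<in>fst Q. \<forall>w\<in>snd Q. v * (y + w) \<in> U)" for y
  proof -
    let ?S = "{q \<in> topspace (prod_topology T T). (\<lambda>(x, y). x * y) q \<in> U}"
    have "openin (prod_topology T T) ?S"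
      by (rule openin_continuous_map_preimage[OF continuous_mult U(1)])
    moreover have "(0, y) \<in> ?S"
      using subspace_0[OF U(2)] by simp
    ultimately have "\<exists>V1 W1. openin T V1 \<and> openin T W1 \<and> 0 \<in> V1 \<and> y \<in> W1 \<and> V1 \<times> W1 \<subseteq> ?S"
      by (rule openin_prod_topology_alt[THEN iffD1, THEN spec, THEN spec, THEN mp])
    then obtain V1 W1 where VW: "openin T V1" "openin T W1" "0 \<in> V1" "y \<in> W1" and sub: "V1 \<times> W1 \<subseteq> ?S"
      by (elim exE conjE)
    obtain V where V: "subspace V" "openin T V" "\<forall>v. v - 0 \<in> V \<longrightarrow> v \<in> V1"
      by (rule openin_nbhd[OF VW(1,3)])
    obtain W where W: "subspace W" "openin T W" "\<forall>w. w - y \<in> W \<longrightarrow> w \<in> W1"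
      by (rule openin_nbhd[OF VW(2,4)])
    have "v * (y + w) \<in> U" if "v \<in> V" "w \<in> W" for v w
    proof -
      have "(v, y + w) \<in> V1 \<times> W1" using V(3) W(3) that by simp
      then show ?thesis using sub by auto
    qed
    then show ?thesis using V(1,2) W(1,2) by (intro exI[of _ "(V, W)"]) simp
  qed
  then have "\<forall>y. \<exists>Q. subspace (fst Q) \<and> openin T (fst Q) \<and> subspace (snd Q) \<and> openin T (snd Q) \<and>
      (\<forall>v\<in>fst Q. \<forall>w\<in>snd Q. v * (y + w) \<in> U)" by simp
  from choice[OF this] obtain Q where Q: "\<forall>y. subspace (fst (Q y)) \<and> openin T (fst (Q y)) \<and>
      subspace (snd (Q y)) \<and> openin T (snd (Q y)) \<and> (\<forall>v\<in>fst (Q y). \<forall>w\<in>snd (Q y). v * (y + w) \<in> U)" ..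
  define V W where "V y = fst (Q y)" and "W y = snd (Q y)" for y
  have VW: "subspace (V y)" "openin T (V y)" "subspace (W y)" "openin T (W y)" for y
    using Q by (simp_all add: V_def W_def)
  have prod: "v * (y + w) \<in> U" if "v \<in> V y" "w \<in> W y" for y v w
    using Q that by (simp add: V_def W_def)
  obtain B where B: "finite B" "\<forall>x. \<exists>y\<in>span B. x - y \<in> W 0"
    using finite_codim_open_subspace[OF VW(4,3)[of 0]] unfolding finite_codim_def by (elim exE conjE)
  define V0 where "V0 = (\<Inter>y\<in>insert 0 B. V y)"
  have V0: "subspace V0" "openin T V0"
    unfolding V0_def using VW(1,2) B(1) by (blast intro: subspace_Int, intro openin_Inter) auto
  define J where "J = {x. \<forall>y. y * x \<in> U}"
  have J: "alg_ideal J"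
    unfolding alg_ideal_def
  proof
    show "subspace J"
      by (rule subspaceI)
         (auto simp: J_def distrib_left subspace_0[OF U(2)] subspace_add[OF U(2)]
            subspace_scale[OF U(2)] smul_mult_right[symmetric])
    show "\<forall>x\<in>J. \<forall>y. y * x \<in> J" by (auto simp: J_def mult.assoc[symmetric])
  qed
  have "V0 \<subseteq> J"
  proof
    fix v assume v: "v \<in> V0"
    have "span B \<subseteq> {y. v * y \<in> U}"
    proof (rule span_minimal)
      show "B \<subseteq> {y. v * y \<in> U}"
        using prod[of v _ 0] v subspace_0[OF VW(3)] by (force simp: V0_def)
      show "subspace {y. v * y \<in> U}"
        by (rule subspaceI) (auto simp: distrib_left subspace_0[OF U(2)] subspace_add[OF U(2)]
            subspace_scale[OF U(2)] smul_mult_right[symmetric])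
    qed
    moreover have "v * w \<in> U" if "w \<in> W 0" for w
      using prod[of v 0 w] v that by (simp add: V0_def)
    ultimately have "v * y + v * (x - y) \<in> U" if "y \<in> span B" "x - y \<in> W 0" for x y
      using that by (intro subspace_add[OF U(2)]) auto
    note split = this
    have "x * v \<in> U" for x
    proof -
      obtain y where "y \<in> span B" "x - y \<in> W 0" using B(2) by blast
      from split[OF this] show ?thesis by (simp add: algebra_simps)
    qed
    then show "v \<in> J" by (simp add: J_def)
  qed
  then have "openin T J"
    using J by (intro openin_superspace[OF V0(2) _ V0(1)]) (simp_all add: alg_ideal_def)
  moreover have "J \<subseteq> U"
  proof
    fix x assume "x \<in> J"
    then have "1 * x \<in> U" unfolding J_def by blast
    then show "x \<in> U" by simp
  qed
  ultimately show ?thesis by (intro that[OF J])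
qed

lemma alg_idealD:
  assumes "alg_ideal J"
  shows "subspace J" "x \<in> J \<Longrightarrow> y * x \<in> J" "x \<in> J \<Longrightarrow> x * y \<in> J"
  using assms by (simp_all add: alg_ideal_def mult.commute)

lemma smul_eq_mult: "c \<cdot> x = (c \<cdot> 1) * x"
  using smul_mult[of c 1 x] by simp

lemma alg_idealI:
  assumes "0 \<in> J" "\<And>x y. x \<in> J \<Longrightarrow> y \<in> J \<Longrightarrow> x + y \<in> J" "\<And>x y. x \<in> J \<Longrightarrow> y * x \<in> J"
  shows "alg_ideal J"
  unfolding alg_ideal_def
proof (intro conjI ballI allI subspaceI)
  show "c \<cdot> x \<in> J" if "x \<in> J" for c x
    by (subst smul_eq_mult) (rule assms(3)[OF that])
qed (use assms in blast)+

end

locale linearly_compact_algebra_acf = linearly_compact_algebra smul T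
  for smul :: "'f::alg_closed_field \<Rightarrow> 'a::comm_ring_1 \<Rightarrow> 'a" and T
begin

text \<open>
  Zorn's lemma above an open proper ideal; all ideals above it are open.
\<close>

lemma open_prime_ideal:
  obtains M where "alg_ideal M" "openin T M" "1 \<notin> M"
    "\<forall>a b. a * b \<in> M \<longrightarrow> a \<in> M \<or> b \<in> M"
proof -
  obtain U where U: "subspace U" "openin T U" "1 \<notin> U"
    by (rule separating_open_subspace[of 1]) simp_all
  obtain J where J: "alg_ideal J" "openin T J" "J \<subseteq> U" by (rule open_ideal_below[OF U(2,1)])
  define \<A> where "\<A> = {K. alg_ideal K \<and> J \<subseteq> K \<and> 1 \<notin> K}"
  have "\<exists>M\<in>\<A>. \<forall>X\<in>\<A>. M \<subseteq> X \<longrightarrow> X = M"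
  proof (rule subset_Zorn_nonempty)
    have "J \<in> \<A>" using J U(3) by (auto simp: \<A>_def)
    then show "\<A> \<noteq> {}" by blast
    fix C assume C: "C \<noteq> {}" "subset.chain \<A> C"
    then have CA: "\<And>K. K \<in> C \<Longrightarrow> alg_ideal K \<and> J \<subseteq> K \<and> 1 \<notin> K" by (auto simp: subset.chain_def \<A>_def)
    have "alg_ideal (\<Union>C)"
    proof (rule alg_idealI)
      show "0 \<in> \<Union>C" using C(1) CA alg_idealD(1) subspace_0 by blast
      show "x + y \<in> \<Union>C" if xy: "x \<in> \<Union>C" "y \<in> \<Union>C" for x y
      proof -
        have "{x, y} \<subseteq> \<Union>C" "finite {x, y}" using xy by auto
        from finite_subset_Union_chain[OF this(2,1) C] obtain K where "K \<in> C" "{x, y} \<subseteq> K" .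
        then show ?thesis using subspace_add[OF alg_idealD(1), of K x y] CA by blast
      qed
      show "y * x \<in> \<Union>C" if "x \<in> \<Union>C" for x y using that CA alg_idealD(2) by blast
    qed
    then show "\<Union>C \<in> \<A>" using CA C(1) by (auto simp: \<A>_def)
  qed
  then obtain M where M: "alg_ideal M" "J \<subseteq> M" "1 \<notin> M"
    and max: "\<And>K. alg_ideal K \<Longrightarrow> J \<subseteq> K \<Longrightarrow> 1 \<notin> K \<Longrightarrow> M \<subseteq> K \<Longrightarrow> K = M"
    unfolding \<A>_def by auto
  have "a \<in> M \<or> b \<in> M" if ab: "a * b \<in> M" for a b
  proof (rule ccontr)
    assume nm: "\<not> (a \<in> M \<or> b \<in> M)"
    define K where "K = {m + a * n | m n. m \<in> M}"
    have "alg_ideal K"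
    proof (rule alg_idealI)
      show "0 \<in> K" unfolding K_def
        by (intro CollectI exI[of _ 0]) (simp add: subspace_0[OF alg_idealD(1)[OF M(1)]])
      fix x assume "x \<in> K"
      then obtain m n where x: "x = m + a * n" "m \<in> M" by (auto simp: K_def)
      show "y * x \<in> K" for y unfolding K_def
        by (intro CollectI exI[of _ "y * m"] exI[of _ "y * n"]) (simp add: x alg_idealD[OF M(1)] algebra_simps)
      fix y assume "y \<in> K"
      then obtain m' n' where y: "y = m' + a * n'" "m' \<in> M" by (auto simp: K_def)
      show "x + y \<in> K" unfolding K_def
        by (intro CollectI exI[of _ "m + m'"] exI[of _ "n + n'"])
           (simp add: x y subspace_add[OF alg_idealD(1)[OF M(1)]] algebra_simps)
    qed
    moreover have "M \<subseteq> K"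
    proof
      fix m assume "m \<in> M"
      then show "m \<in> K" unfolding K_def by (intro CollectI exI[of _ m] exI[of _ 0]) simp
    qed
    moreover have "a \<in> K" unfolding K_def
      by (intro CollectI exI[of _ 0] exI[of _ 1]) (simp add: subspace_0[OF alg_idealD(1)[OF M(1)]])
    ultimately have "1 \<in> K" using max[of K] M(2) nm by blast
    then obtain m n where mn: "1 = m + a * n" "m \<in> M" by (auto simp: K_def)
    have "b = b * (m + a * n)" by (simp add: mn(1)[symmetric])
    also have "\<dots> = b * m + n * (a * b)" by (simp add: algebra_simps)
    also have "\<dots> \<in> M"
      by (intro subspace_add[OF alg_idealD(1)[OF M(1)]] alg_idealD(2)[OF M(1)] mn(2) ab)
    finally show False using nm by blast
  qed
  moreover have "openin T M"
    by (rule openin_superspace[OF J(2) M(2) alg_idealD(1)[OF J(1)] alg_idealD(1)[OF M(1)]])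
  ultimately show ?thesis using M by (intro that[of M]) blast+
qed

text \<open>
  An open prime ideal \<open>M\<close> has finite codimension, so every element \<open>x\<close> satisfies a polynomial equation modulo \<open>M\<close>.
  Over an algebraically closed field, primality gives a scalar congruent to \<open>x\<close>.
\<close>

lemma continuous_character:
  obtains \<theta> :: "'a \<Rightarrow> 'f" where
    "\<forall>x y. \<theta> (x + y) = \<theta> x + \<theta> y" "\<forall>c x. \<theta> (c \<cdot> x) = c * \<theta> x"
    "\<forall>x y. \<theta> (x * y) = \<theta> x * \<theta> y" "\<theta> 1 = 1" "openin T {x. \<theta> x = 0}"
proof -
  obtain M where M: "alg_ideal M" "openin T M" "1 \<notin> M"
    and prime: "\<forall>a b. a * b \<in> M \<longrightarrow> a \<in> M \<or> b \<in> M" by (rule open_prime_ideal)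
  note sub = alg_idealD(1)[OF M(1)]
  have scalar: "c = 0" if "c \<cdot> 1 \<in> M" for c
  proof (rule ccontr)
    assume "c \<noteq> 0"
    then have "(1 / c) \<cdot> (c \<cdot> 1) = 1" by simp
    then show False using M(3) subspace_scale[OF sub that, of "1 / c"] by simp
  qed
  have eigen: "\<exists>c. x - c \<cdot> 1 \<in> M" for x
  proof -
    \<comment> \<open>Evaluation of polynomials at \<open>x\<close>.\<close>
    define ev where "ev q = (\<Sum>k\<le>degree q. coeff q k \<cdot> x ^ k)" for q :: "'f poly"
    have ev_bound: "ev q = (\<Sum>k\<le>n. coeff q k \<cdot> x ^ k)" if "degree q \<le> n" for q n
      unfolding ev_def by (rule sum.mono_neutral_left) (use that in \<open>auto simp: coeff_eq_0\<close>)
    have ev_pCons: "ev (pCons a q) = a \<cdot> 1 + x * ev q" for a q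
    proof -
      have "ev (pCons a q) = (\<Sum>k\<le>Suc (degree q). coeff (pCons a q) k \<cdot> x ^ k)"
        by (rule ev_bound) (rule degree_pCons_le)
      also have "\<dots> = a \<cdot> 1 + (\<Sum>k\<le>degree q. coeff q k \<cdot> x ^ Suc k)"
        by (subst sum.atMost_Suc_shift) simp
      finally show ?thesis by (simp add: ev_def sum_distrib_left smul_mult_right)
    qed
    have ev_diff: "ev (q - r) = ev q - ev r" for q r
      using ev_bound[of "q - r" "max (degree q) (degree r)"] ev_bound[of q "max (degree q) (degree r)"]
        ev_bound[of r "max (degree q) (degree r)"] degree_diff_le_max[of q r]
      by (simp add: scale_left_diff_distrib sum_subtractf)
    have ev_smult: "ev (smult c q) = c \<cdot> ev q" for c q
      using ev_bound[of "smult c q" "degree q"] by (simp add: ev_def scale_sum_right degree_smult_le)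
    have root: "\<exists>c. x - c \<cdot> 1 \<in> M" if "q \<noteq> 0" "ev q \<in> M" for q
      using that
    proof (induction "degree q" arbitrary: q)
      case 0
      then obtain a where a: "q = [:a:]" by (metis degree_eq_zeroE)
      then have "a \<cdot> 1 \<in> M" using 0(3) by (simp add: ev_def)
      then have "a = 0" by (rule scalar)
      then show ?case using a 0(2) by simp
    next
      case (Suc n)
      obtain c where c: "poly q c = 0" using alg_closed_imp_poly_has_root[of q] Suc(2) by auto
      then obtain r where r: "q = [:- c, 1:] * r" using poly_eq_0_iff_dvd by (metis dvdE)
      have r0: "r \<noteq> 0" using r Suc(3) by auto
      have deg: "n = degree r" using Suc(2) r0 degree_mult_eq[of "[:- c, 1:]" r] by (simp add: r del: mult_pCons_left)
      have "[:- c, 1:] * r = pCons 0 r - smult c r" by simp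
      then have "ev q = (x - c \<cdot> 1) * ev r"
        using smul_eq_mult[of c "ev r"] by (simp add: r ev_diff ev_pCons ev_smult algebra_simps)
      then have "x - c \<cdot> 1 \<in> M \<or> ev r \<in> M" using prime Suc(4) by simp
      then show ?case using Suc(1)[OF deg r0] by blast
    qed
    obtain d c where dc: "\<exists>k\<le>d. c k \<noteq> 0" "(\<Sum>k\<le>d. c k \<cdot> x ^ k) \<in> M"
      by (rule finite_codim_dependent[OF finite_codim_open_subspace[OF M(2) sub] sub, of "\<lambda>k. x ^ k"])
    define q where "q = (\<Sum>k\<le>d. monom (c k) k)"
    have coeff: "coeff q k = (if k \<le> d then c k else 0)" for k
      by (auto simp: q_def coeff_sum sum.delta' if_distrib cong: if_cong)
    have "degree q \<le> d" by (rule degree_le) (simp add: coeff)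
    then have "ev q = (\<Sum>k\<le>d. c k \<cdot> x ^ k)" using ev_bound[of q d] by (simp add: coeff)
    moreover have "q \<noteq> 0"
    proof
      assume "q = 0"
      then show False using dc(1) coeff by (metis coeff_0)
    qed
    ultimately show ?thesis using root[of q] dc(2) by simp
  qed
  have "\<forall>x. \<exists>c. x - c \<cdot> 1 \<in> M" using eigen by simp
  from choice[OF this] obtain \<theta> where \<theta>: "\<forall>x. x - \<theta> x \<cdot> 1 \<in> M" ..
  have uniq: "\<theta> x = c" if "x - c \<cdot> 1 \<in> M" for x c
  proof -
    have "(x - \<theta> x \<cdot> 1) - (x - c \<cdot> 1) \<in> M" by (rule subspace_diff[OF sub \<theta>[rule_format] that])
    then have "(c - \<theta> x) \<cdot> 1 \<in> M" by (simp add: scale_left_diff_distrib)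
    then show ?thesis using scalar[of "c - \<theta> x"] by simp
  qed
  show ?thesis
  proof (rule that[of \<theta>]; (intro allI)?)
    show "\<theta> (x + y) = \<theta> x + \<theta> y" for x y
    proof (rule uniq)
      have "(x - \<theta> x \<cdot> 1) + (y - \<theta> y \<cdot> 1) \<in> M" by (rule subspace_add[OF sub \<theta>[rule_format] \<theta>[rule_format]])
      then show "x + y - (\<theta> x + \<theta> y) \<cdot> 1 \<in> M" by (simp add: scale_left_distrib algebra_simps)
    qed
    show "\<theta> (c \<cdot> x) = c * \<theta> x" for c x
    proof (rule uniq)
      have "c \<cdot> (x - \<theta> x \<cdot> 1) \<in> M" by (rule subspace_scale[OF sub \<theta>[rule_format]])
      then show "c \<cdot> x - (c * \<theta> x) \<cdot> 1 \<in> M" by (simp add: scale_right_diff_distrib)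
    qed
    show "\<theta> (x * y) = \<theta> x * \<theta> y" for x y
    proof (rule uniq)
      have "y * (x - \<theta> x \<cdot> 1) + \<theta> x \<cdot> (y - \<theta> y \<cdot> 1) \<in> M"
        by (rule subspace_add[OF sub alg_idealD(2)[OF M(1) \<theta>[rule_format]] subspace_scale[OF sub \<theta>[rule_format]]])
      moreover have "y * (\<theta> x \<cdot> 1) = \<theta> x \<cdot> y" using smul_mult_right[of "\<theta> x" y 1] by simp
      ultimately show "x * y - (\<theta> x * \<theta> y) \<cdot> 1 \<in> M"
        by (simp add: scale_right_diff_distrib algebra_simps)
    qed
    show "\<theta> 1 = 1" by (rule uniq) (simp add: subspace_0[OF sub])
    have "{x. \<theta> x = 0} = M"
    proof (intro set_eqI iffI)
      fix x
      show "x \<in> {x. \<theta> x = 0}" if "x \<in> M" using uniq[of x 0] that by simp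
      show "x \<in> M" if "x \<in> {x. \<theta> x = 0}" using \<theta>[rule_format, of x] that by simp
    qed
    then show "openin T {x. \<theta> x = 0}" using M(2) by simp
  qed
qed

end

section \<open>Differentially simple algebras\<close>

text \<open>
  A linearly compact algebra with a continuous character \<open>\<theta>\<close> and a set \<open>H\<close> of continuous derivations,
  such that no proper nonzero ideal is stable under all of \<open>H\<close>.
\<close>

locale differentially_simple_algebra = linearly_compact_algebra smul T
  for smul :: "'f::field \<Rightarrow> 'a::comm_ring_1 \<Rightarrow> 'a" and T +
  fixes \<theta> :: "'a \<Rightarrow> 'f" and H :: "('a \<Rightarrow> 'a) set"
  assumes \<theta>_add: "\<theta> (x + y) = \<theta> x + \<theta> y"
    and \<theta>_scale: "\<theta> (smul c x) = c * \<theta> x"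
    and \<theta>_mult: "\<theta> (x * y) = \<theta> x * \<theta> y"
    and \<theta>_1: "\<theta> 1 = 1"
    and \<theta>_open: "openin T {x. \<theta> x = 0}"
    and D_add: "D \<in> H \<Longrightarrow> D (x + y) = D x + D y"
    and D_scale: "D \<in> H \<Longrightarrow> D (smul c x) = smul c (D x)"
    and D_mult: "D \<in> H \<Longrightarrow> D (x * y) = D x * y + x * D y"
    and D_continuous: "D \<in> H \<Longrightarrow> continuous_map T T D"
    and H_simple: "alg_ideal J \<Longrightarrow> (\<And>D x. D \<in> H \<Longrightarrow> x \<in> J \<Longrightarrow> D x \<in> J) \<Longrightarrow> J = {0} \<or> J = UNIV"
begin

lemma \<theta>_0: "\<theta> 0 = 0" using \<theta>_scale[of 0 0] by simp
lemma \<theta>_diff: "\<theta> (x - y) = \<theta> x - \<theta> y" using \<theta>_add[of "x - y" y] by simp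
lemma D_0: "D \<in> H \<Longrightarrow> D 0 = 0" using D_add[of D 0 0] by simp

text \<open>
  \<open>vanishing k\<close> consists of the elements all of whose iterated derivatives of order less than \<open>k\<close>
  are annihilated by \<open>\<theta>\<close>.
\<close>

primrec vanishing :: "nat \<Rightarrow> 'a set" where
  "vanishing 0 = UNIV"
| "vanishing (Suc k) = {x. \<theta> x = 0 \<and> (\<forall>D\<in>H. D x \<in> vanishing k)}"

lemma vanishing_0: "0 \<in> vanishing k"
  by (induction k) (simp_all add: \<theta>_0 D_0)

lemma vanishing_add: "x \<in> vanishing k \<Longrightarrow> y \<in> vanishing k \<Longrightarrow> x + y \<in> vanishing k"
  by (induction k arbitrary: x y) (simp_all add: \<theta>_add D_add)

lemma vanishing_Suc_subset: "vanishing (Suc k) \<subseteq> vanishing k"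
proof (induction k)
  case (Suc k)
  show ?case
  proof
    fix x assume x: "x \<in> vanishing (Suc (Suc k))"
    then have "\<theta> x = 0" "\<forall>D\<in>H. D x \<in> vanishing (Suc k)" by simp_all
    then show "x \<in> vanishing (Suc k)" using Suc by auto
  qed
qed simp

lemma vanishing_mult: "x \<in> vanishing k \<Longrightarrow> y * x \<in> vanishing k"
proof (induction k arbitrary: x y)
  case (Suc k)
  have "D (y * x) \<in> vanishing k" if D: "D \<in> H" for D
  proof -
    have "x \<in> vanishing k" using Suc.prems vanishing_Suc_subset by blast
    moreover have "D x \<in> vanishing k" using Suc.prems D by simp
    ultimately show ?thesis using Suc.IH[of x "D y"] Suc.IH[of "D x" y]
      by (simp add: D_mult[OF D] vanishing_add)
  qed
  then show ?case using Suc.prems by (simp add: \<theta>_mult)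
qed simp

lemma vanishing_mult_Suc: "\<theta> y = 0 \<Longrightarrow> x \<in> vanishing k \<Longrightarrow> y * x \<in> vanishing (Suc k)"
proof (induction k arbitrary: x)
  case 0
  then show ?case by (simp add: \<theta>_mult)
next
  case (Suc k)
  have "D (y * x) \<in> vanishing (Suc k)" if D: "D \<in> H" for D
  proof -
    have "D y * x \<in> vanishing (Suc k)" using Suc.prems(2) by (rule vanishing_mult)
    moreover have "y * D x \<in> vanishing (Suc k)"
      using Suc.prems D by (intro Suc.IH) simp_all
    ultimately show ?thesis by (simp only: D_mult[OF D] vanishing_add)
  qed
  then show ?case using Suc.prems(1) by (subst vanishing.simps) (simp add: \<theta>_mult)
qed

lemma alg_ideal_vanishing: "alg_ideal (vanishing k)"
  by (rule alg_idealI) (fact vanishing_0 vanishing_add vanishing_mult)+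

lemma closedin_vanishing: "closedin T (vanishing k)"
proof (induction k)
  case 0
  show ?case using closedin_topspace[of T] by simp
next
  case (Suc k)
  have ker: "closedin T {x. \<theta> x = 0}"
    by (rule closedin_open_subspace[OF \<theta>_open], rule subspaceI)
       (simp_all add: \<theta>_0 \<theta>_add \<theta>_scale)
  have "closedin T {x. D x \<in> vanishing k}" if "D \<in> H" for D
    using closedin_continuous_map_preimage[OF D_continuous[OF that] Suc] by simp
  \<comment> \<open>The zero map is added so that the intersection has a nonempty index set.\<close>
  then have "closedin T (\<Inter>D\<in>insert (\<lambda>_. 0) H. {x. \<theta> x = 0} \<inter> {x. D x \<in> vanishing k})"
    using ker vanishing_0 closedin_topspace[of T] by (intro closedin_INT closedin_Int) auto
  also have "(\<Inter>D\<in>insert (\<lambda>_. 0) H. {x. \<theta> x = 0} \<inter> {x. D x \<in> vanishing k}) = vanishing (Suc k)"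
    using vanishing_0 by auto
  finally show ?case .
qed

lemma vanishing_inter:
  assumes "\<And>k. x \<in> vanishing k"
  shows "x = 0"
proof -
  let ?J = "{x. \<forall>k. x \<in> vanishing k}"
  have "alg_ideal ?J"
    by (rule alg_idealI) (simp_all add: vanishing_0 vanishing_add vanishing_mult)
  moreover have "D x \<in> ?J" if D: "D \<in> H" and x: "x \<in> ?J" for D x
  proof -
    have "D x \<in> vanishing k" for k
    proof -
      have "x \<in> vanishing (Suc k)" using x by blast
      then show ?thesis using D by simp
    qed
    then show ?thesis by simp
  qed
  ultimately have "?J = {0} \<or> ?J = UNIV" by (rule H_simple)
  moreover have "1 \<notin> vanishing (Suc 0)" by (simp add: \<theta>_1)
  then have "?J \<noteq> UNIV" by blast
  ultimately show ?thesis using assms by auto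
qed

lemma vanishing_subset_open:
  assumes "openin T J" "subspace J"
  obtains k where "vanishing k \<subseteq> J"
  by (rule chevalley[of vanishing J])
     (use assms in \<open>simp_all only: closedin_vanishing alg_idealD(1)[OF alg_ideal_vanishing]
        vanishing_Suc_subset vanishing_inter\<close>)

lemma continuous_mult_left: "continuous_map T T (\<lambda>y. a * y)"
proof -
  have "continuous_map T (prod_topology T T) (\<lambda>y. (a, y))"
    by (intro continuous_map_pairedI) simp_all
  from continuous_map_compose[OF this continuous_mult] show ?thesis by (simp add: comp_def)
qed

text \<open>
  Up to a scalar \<open>u = 1 - m\<close> with \<open>\<theta> m = 0\<close>, and the partial sums of the geometric series of \<open>m\<close> are inverses
  of \<open>1 - m\<close> modulo \<open>vanishing k\<close>; compactness turns these approximate inverses into an exact one.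
\<close>

lemma invertible:
  assumes "\<theta> u \<noteq> 0"
  obtains v where "u * v = 1"
proof -
  define m where "m = 1 - (1 / \<theta> u) \<cdot> u"
  have m: "\<theta> m = 0" using assms by (simp add: m_def \<theta>_diff \<theta>_1 \<theta>_scale)
  have pow: "m ^ k \<in> vanishing k" for k
    by (induction k) (use vanishing_mult_Suc[OF m] in \<open>simp_all del: vanishing.simps(2)\<close>)
  define A where "A k = {y. (1 - m) * y - 1 \<in> vanishing k}" for k
  define W where "W k = {y. (1 - m) * y \<in> vanishing k}" for k
  note sub = alg_idealD(1)[OF alg_ideal_vanishing]
  obtain y where y: "\<And>k. y \<in> A k"
  proof (rule decreasing_closed_affine_inter[of A W])
    show "closedin T (A k)" for k
      using closedin_continuous_map_preimage[OF continuous_mult_left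
          closedin_translate[OF closedin_vanishing], of "1 - m" 1 k]
      by (simp add: A_def)
    show "A (Suc k) \<subseteq> A k" for k using vanishing_Suc_subset[of k] by (auto simp: A_def simp del: vanishing.simps)
    show "A k \<noteq> {}" for k
    proof -
      have "(1 - m) * (\<Sum>j<k. m ^ j) = 1 - m ^ k" by (simp add: one_diff_power_eq)
      then have "(\<Sum>j<k. m ^ j) \<in> A k" using subspace_neg[OF sub pow] by (simp add: A_def)
      then show ?thesis by blast
    qed
    show "subspace (W k)" for k
      by (rule subspaceI)
         (simp_all add: W_def distrib_left smul_mult_right[symmetric] subspace_0[OF sub]
            subspace_add[OF sub] subspace_scale[OF sub])
    show "y \<in> A k \<longleftrightarrow> y - x \<in> W k" if x: "x \<in> A k" for k x y
    proof -
      have eq: "(1 - m) * (y - x) = ((1 - m) * y - 1) - ((1 - m) * x - 1)" by (simp add: algebra_simps)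
      have x': "(1 - m) * x - 1 \<in> vanishing k" using x by (simp add: A_def)
      show ?thesis
      proof
        assume "y \<in> A k"
        then have "(1 - m) * y - 1 \<in> vanishing k" by (simp add: A_def)
        from subspace_diff[OF sub this x'] show "y - x \<in> W k" unfolding W_def mem_Collect_eq eq .
      next
        assume "y - x \<in> W k"
        then have "(1 - m) * (y - x) \<in> vanishing k" by (simp add: W_def)
        from subspace_add[OF sub this x'] show "y \<in> A k" unfolding eq by (simp add: A_def)
      qed
    qed
  qed (rule that)
  have "(1 - m) * y - 1 = 0"
    by (rule vanishing_inter) (use y in \<open>simp add: A_def\<close>)
  moreover have "(1 - m) * y = u * ((1 / \<theta> u) \<cdot> y)"
    by (simp add: m_def smul_mult[symmetric] smul_mult_right[symmetric])
  ultimately show ?thesis by (intro that[of "(1 / \<theta> u) \<cdot> y"]) simp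
qed

end

section \<open>Decomposability of the bracket\<close>

locale nambu_poisson_algebra_char_0 = nambu_poisson_algebra smul bracket
  for smul :: "'f::field_char_0 \<Rightarrow> 'a::comm_ring_1 \<Rightarrow> 'a"
    and bracket :: "('n::finite \<Rightarrow> 'a) \<Rightarrow> 'a"
begin

lemma bracket_add: "bracket (a(k := x + y)) = bracket (a(k := x)) + bracket (a(k := y))"
  and bracket_scale: "bracket (a(k := smul c x)) = smul c (bracket (a(k := x)))"
  using multilinear[of a k] by (simp_all add: Vector_Spaces.linear_iff)

lemma bracket_0: "bracket (a(k := 0)) = 0"
  using bracket_scale[of a k 0 0] by simp

lemma bracket_swap:
  assumes "p \<noteq> q"
  shows "bracket (a(p := x, q := y)) = - bracket (a(p := y, q := x))"
proof -
  have "a(p := x, q := y) = a(p := y, q := x) \<circ> Transposition.transpose p q"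
    using assms by (auto simp: fun_eq_iff Transposition.transpose_def)
  moreover have "Transposition.transpose p q permutes UNIV" by (rule permutes_swap_id) simp_all
  ultimately show ?thesis
    using skew_symmetric[of "Transposition.transpose p q" "a(p := y, q := x)"] assms
    by (simp add: sign_swap_id)
qed

lemma eq_minus_self:
  assumes "x = - (x :: 'a)"
  shows "x = 0"
proof -
  have "smul 2 x = smul 1 x + smul 1 x" by (simp only: scale_left_distrib[symmetric] one_add_one)
  also have "\<dots> = 0" using assms by (simp add: eq_neg_iff_add_eq_0)
  finally show ?thesis by simp
qed

lemma bracket_alternating:
  assumes "p \<noteq> q" "a p = a q"
  shows "bracket a = 0"
proof (rule eq_minus_self)
  have "a = a(p := a p, q := a p)" using assms by auto
  then show "bracket a = - bracket a" using bracket_swap[OF assms(1), of a "a p" "a p"] by simp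
qed

text \<open>
  The Filippov-Jacobi identity with the product \<open>x * y\<close> in the slot \<open>p\<close> of the outer bracket. By the Leibniz
  rule, \<open>y\<close> times the identity for \<open>x\<close> and \<open>x\<close> times the identity for \<open>y\<close> split off; what remains is
  quadratic in the bracket.
\<close>

lemma symbol_identity:
  assumes pq: "p \<noteq> q"
  shows "(\<Sum>i\<in>UNIV. bracket (b(i := x)) * bracket (c(p := y, q := b i)) +
    bracket (b(i := y)) * bracket (c(p := x, q := b i))) = 0"
proof -
  define X where "X w = bracket (c(p := x, q := w))" for w
  define Y where "Y w = bracket (c(p := y, q := w))" for w
  have Z: "bracket (c(p := x * y, q := w)) = X w * y + x * Y w" for w
    using leibniz[of "c(q := w)" p x y] pq by (simp add: X_def Y_def fun_upd_twist)
  have fj: "bracket (c(p := z, q := bracket b)) = (\<Sum>i\<in>UNIV. bracket (b(i := bracket (c(p := z, q := b i)))))" for z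
    using filippov_jacobi[of "c(p := z)" q b] .
  have "X (bracket b) * y + x * Y (bracket b) = (\<Sum>i\<in>UNIV. bracket (b(i := X (b i) * y + x * Y (b i))))"
    using fj[of "x * y"] by (simp only: Z)
  also have "\<dots> = (\<Sum>i\<in>UNIV. bracket (b(i := X (b i)))) * y + x * (\<Sum>i\<in>UNIV. bracket (b(i := Y (b i))))
     + (\<Sum>i\<in>UNIV. bracket (b(i := x)) * Y (b i) + bracket (b(i := y)) * X (b i))"
    by (simp add: bracket_add leibniz sum.distrib sum_distrib_left sum_distrib_right algebra_simps)
  also have "\<dots> = X (bracket b) * y + x * Y (bracket b)
     + (\<Sum>i\<in>UNIV. bracket (b(i := x)) * Y (b i) + bracket (b(i := y)) * X (b i))"
    using fj[of x] fj[of y] by (simp add: X_def Y_def)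
  finally show ?thesis by (simp add: X_def Y_def)
qed

end

text \<open>
  A frame in an algebra whose bracket has more than two slots: elements \<open>f i\<close> whose bracket has an
  inverse \<open>v\<close>.
\<close>

locale nambu_frame = nambu_poisson_algebra_char_0 smul bracket
  for smul :: "'f::field_char_0 \<Rightarrow> 'a::comm_ring_1 \<Rightarrow> 'a"
    and bracket :: "('n::finite \<Rightarrow> 'a) \<Rightarrow> 'a" +
  fixes f :: "'n \<Rightarrow> 'a" and v :: 'a
  assumes card_gt_2: "CARD('n) > 2"
    and v_inverse: "bracket f * v = 1"
begin

abbreviation u :: 'a where "u \<equiv> bracket f"

text \<open>
  The derivations dual to the frame: \<open>der i (f j)\<close> is \<open>1\<close> if \<open>i = j\<close> and \<open>0\<close> otherwise.
\<close>

definition der :: "'n \<Rightarrow> 'a \<Rightarrow> 'a" where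
  "der i g = v * bracket (f(i := g))"

lemma bracket_f_upd: "bracket (f(i := g)) = u * der i g"
  using v_inverse by (simp add: der_def mult.assoc[symmetric])

lemma u_cancel: "u * x = u * y \<longleftrightarrow> x = y"
proof
  assume "u * x = u * y"
  then have "v * (u * x) = v * (u * y)" by simp
  then show "x = y" using v_inverse by (simp add: mult.assoc[symmetric] mult.commute[of v])
qed simp

lemma der_f: "der i (f j) = (if i = j then 1 else 0)"
proof (cases "i = j")
  case True then show ?thesis using v_inverse by (simp add: der_def mult.commute)
next
  case False
  then have "bracket (f(i := f j)) = 0" by (intro bracket_alternating[of i j]) auto
  then show ?thesis using False by (simp add: der_def)
qed

lemma der_add: "der i (x + y) = der i x + der i y"
  by (simp add: der_def bracket_add distrib_left)

lemma der_mult: "der i (x * y) = der i x * y + x * der i y"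
  by (simp add: der_def leibniz distrib_left mult_ac)

lemma der_scale: "der i (smul c x) = smul c (der i x)"
  using smul_mult[of c "bracket (f(i := x))" v] by (simp add: der_def bracket_scale mult.commute)

text \<open>
  The case of a bracket that already has a frame element in some slot \<open>p\<close>: the symbol identity for
  the frame and \<open>x = f r\<close>.
\<close>

lemma frame_expansion_aux:
  assumes pq: "p \<noteq> q" and c: "c p = f r"
  shows "bracket (c(q := y)) = (\<Sum>i\<in>UNIV. der i y * bracket (c(q := f i)))"
proof -
  have cp: "c(p := f r) = c" using c by auto
  have swap: "bracket (c(p := y, q := f r)) = - bracket (c(q := y))"
    using bracket_swap[OF pq, of c y "f r"] by (simp only: cp)
  have "0 = (\<Sum>i\<in>UNIV. u * der i (f r) * bracket (c(p := y, q := f i)) + u * der i y * bracket (c(q := f i)))"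
    using symbol_identity[OF pq, of f "f r" c y] by (simp only: cp bracket_f_upd)
  also have "\<dots> = (\<Sum>i\<in>UNIV. u * der i (f r) * bracket (c(p := y, q := f i))) +
      u * (\<Sum>i\<in>UNIV. der i y * bracket (c(q := f i)))"
    by (simp add: sum.distrib sum_distrib_left mult.assoc)
  also have "(\<Sum>i\<in>UNIV. u * der i (f r) * bracket (c(p := y, q := f i))) = u * bracket (c(p := y, q := f r))"
    by (subst sum.mono_neutral_right[of UNIV "{r}"]) (auto simp: der_f)
  finally have "0 = u * - bracket (c(q := y)) + u * (\<Sum>i\<in>UNIV. der i y * bracket (c(q := f i)))"
    unfolding swap .
  then have "u * (\<Sum>i\<in>UNIV. der i y * bracket (c(q := f i))) - u * bracket (c(q := y)) = 0"
    by (simp only: mult_minus_right diff_conv_add_uminus add.commute)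
  then show ?thesis by (simp only: right_minus_eq u_cancel)
qed

text \<open>
  As \<open>CARD('n) > 2\<close>, a bracket with frame elements in all slots except two still has one in a third slot,
  so that the previous lemma computes it.
\<close>

lemma bracket_f_upd2:
  assumes ir: "i \<noteq> r"
  shows "bracket (f(r := k, i := y)) = u * (der r k * der i y - der i k * der r y)"
proof -
  have "\<exists>j. j \<notin> {i, r}"
  proof (rule ccontr)
    assume "\<not> ?thesis"
    then have "UNIV = {i, r}" by auto
    then have "CARD('n) = card {i, r}" by simp
    then show False using card_gt_2 ir by simp
  qed
  then obtain j where j: "j \<noteq> i" "j \<noteq> r" by auto
  have "bracket (f(r := k, i := y)) = bracket (f(i := y, r := k))"
    using ir by (simp add: fun_upd_twist)
  also have "\<dots> = (\<Sum>m\<in>UNIV. der m k * bracket (f(i := y, r := f m)))"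
    by (rule frame_expansion_aux[of j r _ j]) (use j in auto)
  also have "\<dots> = (\<Sum>m\<in>{r, i}. der m k * bracket (f(i := y, r := f m)))"
  proof (rule sum.mono_neutral_right)
    show "\<forall>m\<in>UNIV - {r, i}. der m k * bracket (f(i := y, r := f m)) = 0"
    proof
      fix m assume m: "m \<in> UNIV - {r, i}"
      then have "bracket (f(i := y, r := f m)) = 0" by (intro bracket_alternating[of m r]) auto
      then show "der m k * bracket (f(i := y, r := f m)) = 0" by simp
    qed
  qed simp_all
  also have "\<dots> = der r k * bracket (f(i := y)) + der i k * bracket (f(i := y, r := f i))"
  proof -
    have "f(i := y, r := f r) = f(i := y)" using ir by auto
    then show ?thesis using ir by simp
  qed
  also have "bracket (f(i := y, r := f i)) = - bracket (f(r := y))"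
    using bracket_swap[of i r f y "f i"] ir by simp
  finally have eq: "bracket (f(r := k, i := y)) =
    der r k * bracket (f(i := y)) + der i k * - bracket (f(r := y))" .
  show ?thesis unfolding eq bracket_f_upd by (simp add: algebra_simps)
qed

text \<open>
  The symbol identity for the family \<open>f(r := k)\<close> and \<open>x = f r\<close>, where \<open>y\<close> is the entry of \<open>c\<close> in a slot
  \<open>p \<noteq> q\<close>. The brackets of \<open>c\<close> with \<open>f r\<close> in the slot \<open>p\<close> and the brackets of the frame with two
  altered entries are known from the previous two lemmas; only the brackets of the statement remain.
\<close>

lemma frame_expansion:
  "bracket (c(q := k)) = (\<Sum>i\<in>UNIV. der i k * bracket (c(q := f i)))"
proof -
  have "\<exists>p. p \<noteq> q"
  proof (rule ccontr)
    assume "\<not> ?thesis"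
    then have "UNIV = {q}" by auto
    then have "CARD('n) = card {q}" by simp
    then show False using card_gt_2 by simp
  qed
  then obtain p where pq: "p \<noteq> q" by blast
  obtain r :: 'n where True by blast
  define y where "y = c p"
  define E where "E w = bracket (c(p := f r, q := w))" for w
  define C where "C i = bracket (c(q := f i))" for i
  have cp: "c(p := y) = c" by (auto simp: y_def)
  have E: "E w = (\<Sum>i\<in>UNIV. der i w * E (f i))" for w
    unfolding E_def by (rule frame_expansion_aux[OF pq, of _ r]) simp
  have Er: "E (f r) = 0" unfolding E_def by (rule bracket_alternating[OF pq]) (use pq in simp)
  have Ey: "E y = - C r"
    unfolding E_def C_def using bracket_swap[OF pq, of c "f r" y] by (simp only: cp)
  have "0 = (\<Sum>i\<in>UNIV. bracket (f(r := k, i := f r)) * bracket (c(p := y, q := (f(r := k)) i)) +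
      bracket (f(r := k, i := y)) * bracket (c(p := f r, q := (f(r := k)) i)))"
    by (rule symbol_identity[OF pq, symmetric])
  also have "\<dots> = (\<Sum>i\<in>UNIV. bracket (f(r := k, i := f r)) * bracket (c(q := (f(r := k)) i)) +
      bracket (f(r := k, i := y)) * E ((f(r := k)) i))"
    by (simp only: cp E_def)
  also have "\<dots> = u * bracket (c(q := k)) + u * der r y * E k +
      (\<Sum>i\<in>UNIV - {r}. bracket (f(r := k, i := f r)) * bracket (c(q := (f(r := k)) i)) +
      bracket (f(r := k, i := y)) * E ((f(r := k)) i))"
    by (subst sum.remove[of UNIV r]) (simp_all add: bracket_f_upd)
  also have "(\<Sum>i\<in>UNIV - {r}. bracket (f(r := k, i := f r)) * bracket (c(q := (f(r := k)) i)) +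
      bracket (f(r := k, i := y)) * E ((f(r := k)) i)) =
      (\<Sum>i\<in>UNIV - {r}. - u * der i k * C i + u * (der r k * der i y - der i k * der r y) * E (f i))"
  proof (rule sum.cong)
    fix i assume "i \<in> UNIV - {r}"
    then have ir: "i \<noteq> r" by simp
    have "bracket (f(r := k, i := f r)) = - bracket (f(i := k))"
      using bracket_swap[of r i f k "f r"] ir by simp
    then show "bracket (f(r := k, i := f r)) * bracket (c(q := (f(r := k)) i)) +
      bracket (f(r := k, i := y)) * E ((f(r := k)) i) =
      - u * der i k * C i + u * (der r k * der i y - der i k * der r y) * E (f i)"
      using ir by (simp add: bracket_f_upd bracket_f_upd2[OF ir] C_def)
  qed simp
  also have "\<dots> = - u * (\<Sum>i\<in>UNIV - {r}. der i k * C i) + u * der r k * (\<Sum>i\<in>UNIV - {r}. der i y * E (f i))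
      - u * der r y * (\<Sum>i\<in>UNIV - {r}. der i k * E (f i))"
    by (simp add: sum.distrib sum_subtractf sum_negf sum_distrib_left algebra_simps)
  also have "(\<Sum>i\<in>UNIV - {r}. der i y * E (f i)) = E y"
    by (subst (2) E) (simp add: sum.remove[of UNIV r] Er)
  also have "(\<Sum>i\<in>UNIV - {r}. der i k * E (f i)) = E k"
    by (subst (2) E) (simp add: sum.remove[of UNIV r] Er)
  finally have "0 = u * bracket (c(q := k)) + u * der r y * E k +
      (- u * (\<Sum>i\<in>UNIV - {r}. der i k * C i) + u * der r k * E y - u * der r y * E k)" .
  also have "\<dots> = u * bracket (c(q := k)) - u * (der r k * C r + (\<Sum>i\<in>UNIV - {r}. der i k * C i))"
    unfolding Ey by (simp add: algebra_simps)
  also have "der r k * C r + (\<Sum>i\<in>UNIV - {r}. der i k * C i) = (\<Sum>i\<in>UNIV. der i k * C i)"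
    by (rule sum.remove[symmetric]) simp_all
  finally have "u * bracket (c(q := k)) - u * (\<Sum>i\<in>UNIV. der i k * C i) = 0" by (rule sym)
  then have "u * bracket (c(q := k)) = u * (\<Sum>i\<in>UNIV. der i k * C i)"
    by (simp only: right_minus_eq)
  then show ?thesis unfolding u_cancel C_def .
qed

text \<open>
  The Hamiltonian derivation \<open>u * der i\<close> is a derivation of the bracket, and this is applied to \<open>f(j := g)\<close>.
  The terms that contain derivatives of \<open>u\<close> cancel.
\<close>

lemma der_commute: "der i (der j g) = der j (der i g)"
proof (cases "i = j")
  case ij: False
  define b where "b = f(j := g)"
  have "bracket (f(i := bracket b)) = (\<Sum>l\<in>UNIV. bracket (b(l := bracket (f(i := b l)))))"
    by (rule filippov_jacobi)
  also have "\<dots> = (\<Sum>l\<in>{i, j}. bracket (b(l := bracket (f(i := b l)))))"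
  proof (rule sum.mono_neutral_right)
    show "\<forall>l\<in>UNIV - {i, j}. bracket (b(l := bracket (f(i := b l)))) = 0"
    proof
      fix l assume l: "l \<in> UNIV - {i, j}"
      then have "bracket (f(i := b l)) = 0" unfolding b_def by (intro bracket_alternating[of i l]) auto
      then show "bracket (b(l := bracket (f(i := b l)))) = 0" by (simp add: bracket_0)
    qed
  qed simp_all
  also have "\<dots> = bracket (f(j := g, i := u)) + bracket (f(j := bracket (f(i := g))))"
    using ij by (simp add: b_def)
  finally have "u * der i (u * der j g) = u * (der j g * der i u - der i g * der j u) + u * der j (u * der i g)"
    using bracket_f_upd2[OF ij, of g u] unfolding b_def bracket_f_upd by simp
  then have "u * der i (u * der j g) = u * (der j g * der i u - der i g * der j u + der j (u * der i g))"
    by (simp only: distrib_left)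
  then have "u * der i (der j g) = u * der j (der i g)"
    unfolding u_cancel der_mult by (simp only: algebra_simps u_cancel add_left_cancel) (simp add: u_cancel)
  then show ?thesis unfolding u_cancel .
qed simp

text \<open>
  The slots in \<open>S\<close> are expanded one after the other.
\<close>

lemma bracket_expansion:
  assumes "finite S"
  shows "bracket a = (\<Sum>\<sigma>\<in>PiE S (\<lambda>_. UNIV). (\<Prod>i\<in>S. der (\<sigma> i) (a i)) *
    bracket (\<lambda>i. if i \<in> S then f (\<sigma> i) else a i))"
  using assms
proof (induction S)
  case empty
  then show ?case by simp
next
  case (insert s S)
  let ?F = "\<lambda>\<sigma> S. (\<Prod>i\<in>S. der (\<sigma> i) (a i)) * bracket (\<lambda>i. if i \<in> S then f (\<sigma> i) else a i)"
  have "?F \<sigma> S = (\<Sum>m\<in>UNIV. ?F (\<sigma>(s := m)) (insert s S))" for \<sigma>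
  proof -
    let ?c = "\<lambda>i. if i \<in> S then f (\<sigma> i) else a i"
    have "bracket ?c = bracket (?c(s := a s))" using insert.hyps(2) by (intro arg_cong[of _ _ bracket]) auto
    also have "\<dots> = (\<Sum>m\<in>UNIV. der m (a s) * bracket (?c(s := f m)))" by (rule frame_expansion)
    also have "\<dots> = (\<Sum>m\<in>UNIV. der m (a s) * bracket (\<lambda>i. if i \<in> insert s S then f ((\<sigma>(s := m)) i) else a i))"
      by (intro sum.cong refl arg_cong2[of _ _ _ _ "(*)"] arg_cong[of _ _ bracket]) (auto simp: fun_eq_iff)
    finally have br: "bracket ?c = \<dots>" .
    have "(\<Prod>i\<in>S. der ((\<sigma>(s := m)) i) (a i)) = (\<Prod>i\<in>S. der (\<sigma> i) (a i))" for m
      using insert.hyps(2) by (intro prod.cong) auto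
    then have pr: "(\<Prod>i\<in>insert s S. der ((\<sigma>(s := m)) i) (a i)) = der m (a s) * (\<Prod>i\<in>S. der (\<sigma> i) (a i))" for m
      using insert.hyps by simp
    show ?thesis unfolding br pr sum_distrib_left by (simp only: mult_ac)
  qed
  then have "bracket a = (\<Sum>\<sigma>\<in>PiE S (\<lambda>_. UNIV). \<Sum>m\<in>UNIV. ?F (\<sigma>(s := m)) (insert s S))"
    using insert.IH by simp
  also have "\<dots> = (\<Sum>m\<in>UNIV. \<Sum>\<sigma>\<in>PiE S (\<lambda>_. UNIV). ?F (\<sigma>(s := m)) (insert s S))"
    by (rule sum.swap)
  also have "\<dots> = (\<Sum>(m, \<sigma>)\<in>UNIV \<times> PiE S (\<lambda>_. UNIV). ?F (\<sigma>(s := m)) (insert s S))"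
    by (rule sum.cartesian_product)
  also have "\<dots> = (\<Sum>\<sigma>\<in>(\<lambda>(m, \<sigma>). \<sigma>(s := m)) ` (UNIV \<times> PiE S (\<lambda>_. UNIV)). ?F \<sigma> (insert s S))"
    unfolding sum.reindex[OF inj_combinator[OF insert.hyps(2), of "\<lambda>_. UNIV :: 'n set"]] comp_def case_prod_beta ..
  also have "(\<lambda>(m, \<sigma>). \<sigma>(s := m)) ` (UNIV \<times> PiE S (\<lambda>_. UNIV)) = PiE (insert s S) (\<lambda>_. UNIV :: 'n set)"
    by (rule PiE_insert_eq[symmetric])
  finally show ?case .
qed

lemma bracket_eq_det: "bracket a = u * det (\<chi> i j. der j (a i))"
proof -
  have "bracket a = (\<Sum>\<sigma>\<in>UNIV. (\<Prod>i\<in>UNIV. der (\<sigma> i) (a i)) * bracket (\<lambda>i. f (\<sigma> i)))"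
    using bracket_expansion[of UNIV a] by (simp add: PiE_UNIV_domain)
  also have "\<dots> = (\<Sum>\<sigma>\<in>{\<sigma>. \<sigma> permutes UNIV}. (\<Prod>i\<in>UNIV. der (\<sigma> i) (a i)) * bracket (\<lambda>i. f (\<sigma> i)))"
  proof (rule sum.mono_neutral_right)
    show "\<forall>\<sigma>\<in>UNIV - {\<sigma>. \<sigma> permutes UNIV}. (\<Prod>i\<in>UNIV. der (\<sigma> i) (a i)) * bracket (\<lambda>i. f (\<sigma> i)) = 0"
    proof
      fix \<sigma> :: "'n \<Rightarrow> 'n" assume "\<sigma> \<in> UNIV - {\<sigma>. \<sigma> permutes UNIV}"
      then have "\<not> inj \<sigma>" using finite_UNIV_inj_surj[of \<sigma>] bij_imp_permutes[of \<sigma> UNIV] by (auto simp: bij_betw_def)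
      then obtain p q where "p \<noteq> q" "\<sigma> p = \<sigma> q" by (auto simp: inj_def)
      then have "bracket (\<lambda>i. f (\<sigma> i)) = 0" by (intro bracket_alternating[of p q]) simp_all
      then show "(\<Prod>i\<in>UNIV. der (\<sigma> i) (a i)) * bracket (\<lambda>i. f (\<sigma> i)) = 0" by simp
    qed
  qed simp_all
  also have "\<dots> = (\<Sum>\<sigma>\<in>{\<sigma>. \<sigma> permutes UNIV}. u * (of_int (sign \<sigma>) * (\<Prod>i\<in>UNIV. der (\<sigma> i) (a i))))"
  proof (rule sum.cong)
    fix \<sigma> :: "'n \<Rightarrow> 'n" assume "\<sigma> \<in> {\<sigma>. \<sigma> permutes UNIV}"
    then have "bracket (f \<circ> \<sigma>) = smul (of_int (sign \<sigma>)) u" using skew_symmetric by blast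
    also have "\<dots> = of_int (sign \<sigma>) * u" by (simp add: sign_def)
    finally show "(\<Prod>i\<in>UNIV. der (\<sigma> i) (a i)) * bracket (\<lambda>i. f (\<sigma> i)) =
      u * (of_int (sign \<sigma>) * (\<Prod>i\<in>UNIV. der (\<sigma> i) (a i)))"
      by (simp add: comp_def mult_ac)
  qed simp
  finally show ?thesis by (simp add: det_def sum_distrib_left)
qed

end

section \<open>Calculus of formal power series\<close>

lemma mfps_coeff_deriv:
  "mfps_coeff (mfps_deriv j f) M = of_nat (Suc (count M j)) * mfps_coeff f (add_mset j M)"
  by (simp add: mfps_deriv.rep_eq)

lemma mfps_coeff_mult:
  "mfps_coeff (f * g) M = (\<Sum>(A, B) | A + B = M. mfps_coeff f A * mfps_coeff g B)"
  by (simp add: times_mfps.rep_eq)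

lemma mfps_coeff_mult_empty: "mfps_coeff (f * g) {#} = mfps_coeff f {#} * mfps_coeff g {#}"
proof -
  have "{(A, B). A + B = {#}} = {({#}, {#})}" by auto
  then show ?thesis by (simp add: mfps_coeff_mult)
qed

lemma mfps_coeff_sum: "mfps_coeff (sum F S) M = (\<Sum>s\<in>S. mfps_coeff (F s) M)"
  by (induction S rule: infinite_finite_induct) (simp_all add: zero_mfps.rep_eq plus_mfps.rep_eq)

lemma sum_splittings_count:
  fixes h :: "'n multiset \<Rightarrow> 'n multiset \<Rightarrow> 'r::comm_ring_1"
  shows "(\<Sum>(A, B) | A + B = add_mset j M. of_nat (count A j) * h A B) =
    (\<Sum>(A, B) | A + B = M. of_nat (Suc (count A j)) * h (add_mset j A) B)"
proof -
  have "(\<Sum>(A, B) | A + B = add_mset j M. of_nat (count A j) * h A B) =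
      (\<Sum>(A, B) | A + B = add_mset j M \<and> j \<in># A. of_nat (count A j) * h A B)"
    by (rule sum.mono_neutral_right[OF finite_splittings_mset])
       (auto, metis not_in_iff mult_zero_left of_nat_0)
  also have "\<dots> = (\<Sum>(A, B) | A + B = M. of_nat (Suc (count A j)) * h (add_mset j A) B)"
    by (rule sum.reindex_bij_witness
          [where i = "\<lambda>(A, B). (add_mset j A, B)" and j = "\<lambda>(A, B). (A - {#j#}, B)"])
       (auto dest!: multi_member_split)
  finally show ?thesis .
qed

lemma mfps_deriv_mult:
  fixes f g :: "('f::comm_ring_1, 'n) mfps"
  shows "mfps_deriv j (f * g) = mfps_deriv j f * g + f * mfps_deriv j g"
proof (unfold mfps_eq_iff, intro allI)
  fix M
  have half: "(\<Sum>(A, B) | A + B = add_mset j M. of_nat (count A j) * (mfps_coeff f A * mfps_coeff g B)) =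
      mfps_coeff (mfps_deriv j f * g) M" for f g :: "('f, 'n) mfps"
    unfolding sum_splittings_count mfps_coeff_mult mfps_coeff_deriv by (simp only: mult.assoc)
  have half': "(\<Sum>(A, B) | A + B = add_mset j M. of_nat (count B j) * (mfps_coeff f A * mfps_coeff g B)) =
      mfps_coeff (mfps_deriv j g * f) M"
    unfolding half[symmetric]
    by (rule sum.reindex_bij_witness[where i = prod.swap and j = prod.swap]) (auto simp: ac_simps)
  have "mfps_coeff (mfps_deriv j (f * g)) M =
      (\<Sum>(A, B) | A + B = add_mset j M. of_nat (Suc (count M j)) * (mfps_coeff f A * mfps_coeff g B))"
    unfolding mfps_coeff_deriv mfps_coeff_mult by (simp add: sum_distrib_left case_prod_beta)
  also have "\<dots> = (\<Sum>(A, B) | A + B = add_mset j M.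
      of_nat (count A j) * (mfps_coeff f A * mfps_coeff g B) +
      of_nat (count B j) * (mfps_coeff f A * mfps_coeff g B))"
  proof (rule sum.cong, goal_cases)
    case (2 q)
    obtain A B where q: "q = (A, B)" by (cases q)
    then have "count (A + B) j = count (add_mset j M) j" using 2 by simp
    then have "of_nat (Suc (count M j)) = (of_nat (count A j) + of_nat (count B j) :: 'f)"
      by (simp flip: of_nat_add)
    then show ?case by (simp only: q prod.case distrib_right)
  qed simp
  also have "\<dots> = mfps_coeff (mfps_deriv j f * g + f * mfps_deriv j g) M"
    using half[of f g] half'
    by (simp add: case_prod_beta sum.distrib plus_mfps.rep_eq mult.commute[of f])
  finally show "mfps_coeff (mfps_deriv j (f * g)) M = \<dots>" .
qed

text \<open>The monomial \<open>M\<close> as a power series.\<close>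

definition mfps_monom :: "'n multiset \<Rightarrow> ('f::comm_ring_1, 'n) mfps" where
  "mfps_monom M = Abs_mfps (\<lambda>N. if N = M then 1 else 0)"

lemma mfps_coeff_monom: "mfps_coeff (mfps_monom M) N = (if N = M then 1 else 0)"
  by (simp add: mfps_monom_def Abs_mfps_inverse)

lemma mfps_monom_empty: "mfps_monom {#} = 1"
  by (simp add: mfps_eq_iff mfps_coeff_monom one_mfps.rep_eq)

lemma mfps_monom_mult: "mfps_monom A * mfps_monom B = (mfps_monom (A + B) :: ('f::comm_ring_1, 'n) mfps)"
proof (unfold mfps_eq_iff, intro allI)
  fix M :: "'n multiset"
  have "mfps_coeff (mfps_monom A * mfps_monom B) M =
      (\<Sum>q | fst q + snd q = M. if q = (A, B) then 1 else (0 :: 'f))"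
    unfolding mfps_coeff_mult mfps_coeff_monom
    by (intro sum.cong) (auto simp: case_prod_beta prod_eq_iff)
  also have "{q. fst q + snd q = M} = {(A, B). A + B = M}" by auto
  then have "finite {q. fst q + snd q = M}" using finite_splittings_mset[of M] by simp
  then have "(\<Sum>q | fst q + snd q = M. if q = (A, B) then 1 else (0 :: 'f)) = (if A + B = M then 1 else 0)"
    by simp
  finally show "mfps_coeff (mfps_monom A * mfps_monom B) M = (mfps_coeff (mfps_monom (A + B)) M :: 'f)"
    by (simp add: mfps_coeff_monom eq_commute)
qed

lemma mfps_antiderivative:
  fixes F :: "('f::field_char_0, 'n) mfps"
  obtains G where "mfps_deriv j G = F"
proof
  show "mfps_deriv j (Abs_mfps (\<lambda>M. mfps_coeff F (M - {#j#}) / of_nat (count M j))) = F"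
    by (simp add: mfps_eq_iff mfps_coeff_deriv Abs_mfps_inverse del: of_nat_Suc)
qed

section \<open>The Taylor isomorphism\<close>

lemma finite_multisets_size: "finite {M :: 'n::finite multiset. size M = k}"
  using finite_multisets_of_size[of "UNIV :: 'n set" k] by (simp add: multisets_of_size_def)

text \<open>
  Commuting derivations \<open>d i\<close> with coordinates \<open>x j\<close>, for which the algebra is differentially simple.
  The coordinates need not be annihilated by \<open>\<theta>\<close>.
\<close>

locale coordinate_derivations = differentially_simple_algebra smul T \<theta> "range d"
  for smul :: "'f::field_char_0 \<Rightarrow> 'a::comm_ring_1 \<Rightarrow> 'a" and T and \<theta>
    and d :: "'n::finite \<Rightarrow> 'a \<Rightarrow> 'a" +
  fixes x :: "'n \<Rightarrow> 'a"
  assumes d_commute: "d i (d j g) = d j (d i g)"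
    and d_x: "d i (x j) = (if i = j then 1 else 0)"
begin

lemma d_add: "d i (g + h) = d i g + d i h" by (rule D_add) simp
lemma d_scale: "d i (c \<cdot> g) = c \<cdot> d i g" by (rule D_scale) simp
lemma d_mult: "d i (g * h) = d i g * h + g * d i h" by (rule D_mult) simp
lemma d_1: "d i 1 = 0" using d_mult[of i 1 1] by simp

text \<open>The iterated derivative with respect to the monomial \<open>M\<close>.\<close>

definition dpow :: "'n multiset \<Rightarrow> 'a \<Rightarrow> 'a" where
  "dpow M g = fold_mset d g M"

interpretation comp_fun_commute d
  by unfold_locales (auto simp: fun_eq_iff d_commute)

lemma dpow_empty: "dpow {#} g = g"
  by (simp add: dpow_def)

lemma dpow_add_mset: "dpow (add_mset j M) g = dpow M (d j g)"
  by (simp add: dpow_def fold_mset_fun_left_comm)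

lemma dpow_add: "dpow M (g + h) = dpow M g + dpow M h"
  by (induction M arbitrary: g h) (simp_all add: dpow_empty dpow_add_mset d_add)

lemma dpow_scale: "dpow M (c \<cdot> g) = c \<cdot> dpow M g"
  by (induction M arbitrary: g) (simp_all add: dpow_empty dpow_add_mset d_scale)

lemma dpow_0: "dpow M 0 = 0"
  using dpow_scale[of M 0 0] by simp

text \<open>The multi-index factorial of the monomial \<open>M\<close>.\<close>

definition mset_fact :: "'n multiset \<Rightarrow> 'f" where
  "mset_fact M = (\<Prod>i\<in>UNIV. fact (count M i))"

lemma mset_fact_nonzero: "mset_fact M \<noteq> 0"
  by (simp add: mset_fact_def)

lemma mset_fact_add_mset: "mset_fact (add_mset j M) = of_nat (Suc (count M j)) * mset_fact M"
proof -
  have "(\<Prod>i\<in>UNIV - {j}. fact (count (add_mset j M) i)) = (\<Prod>i\<in>UNIV - {j}. fact (count M i) :: 'f)"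
    by (intro prod.cong) auto
  then show ?thesis
    unfolding mset_fact_def by (simp add: prod.remove[of UNIV j] algebra_simps)
qed

text \<open>The Taylor series at the character \<open>\<theta>\<close>.\<close>

definition taylor :: "'a \<Rightarrow> ('f, 'n) mfps" where
  "taylor g = Abs_mfps (\<lambda>M. \<theta> (dpow M g) / mset_fact M)"

lemma coeff_taylor: "mfps_coeff (taylor g) M = \<theta> (dpow M g) / mset_fact M"
  by (simp add: taylor_def Abs_mfps_inverse)

lemma coeff_taylor_eq_0_iff: "mfps_coeff (taylor g) M = 0 \<longleftrightarrow> \<theta> (dpow M g) = 0"
  by (simp add: coeff_taylor mset_fact_nonzero)

lemma taylor_add: "taylor (g + h) = taylor g + taylor h"
  by (simp add: mfps_eq_iff plus_mfps.rep_eq coeff_taylor dpow_add \<theta>_add add_divide_distrib)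

lemma taylor_scale: "taylor (c \<cdot> g) = mfps_scale c (taylor g)"
  by (simp add: mfps_eq_iff mfps_scale.rep_eq coeff_taylor dpow_scale \<theta>_scale)

lemma taylor_0: "taylor 0 = 0"
  using taylor_add[of 0 0] by simp

lemma taylor_diff: "taylor (g - h) = taylor g - taylor h"
  using taylor_add[of "g - h" h] by (simp add: algebra_simps)

lemma taylor_sum: "taylor (sum F S) = (\<Sum>s\<in>S. taylor (F s))"
  by (induction S rule: infinite_finite_induct) (simp_all add: taylor_0 taylor_add)

lemma taylor_1: "taylor 1 = 1"
proof (unfold mfps_eq_iff, intro allI)
  fix M :: "'n multiset"
  show "mfps_coeff (taylor 1) M = mfps_coeff 1 M"
    by (cases M) (simp_all add: coeff_taylor one_mfps.rep_eq dpow_empty dpow_add_mset d_1 dpow_0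
        \<theta>_1 \<theta>_0 mset_fact_def)
qed

lemma taylor_d: "taylor (d j g) = mfps_deriv j (taylor g)"
  by (simp add: mfps_eq_iff coeff_taylor mfps_coeff_deriv dpow_add_mset mset_fact_add_mset del: of_nat_Suc)

text \<open>
  By induction on the monomial: by \<open>taylor_d\<close> and the Leibniz rule, the coefficient of \<open>add_mset j M\<close> reduces
  to coefficients of \<open>M\<close> for the products \<open>d j g * h\<close> and \<open>g * d j h\<close>.
\<close>

lemma taylor_mult: "taylor (g * h) = taylor g * taylor h"
proof (unfold mfps_eq_iff, intro allI)
  fix M :: "'n multiset"
  show "mfps_coeff (taylor (g * h)) M = mfps_coeff (taylor g * taylor h) M"
  proof (induction M arbitrary: g h)
    case empty
    show ?case by (simp add: mfps_coeff_mult_empty coeff_taylor dpow_empty \<theta>_mult mset_fact_def)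
  next
    case (add j M)
    have "of_nat (Suc (count M j)) * mfps_coeff (taylor (g * h)) (add_mset j M) =
        mfps_coeff (taylor (d j g * h)) M + mfps_coeff (taylor (g * d j h)) M"
      by (simp only: mfps_coeff_deriv[symmetric] taylor_d[symmetric] d_mult taylor_add plus_mfps.rep_eq)
    also have "\<dots> = of_nat (Suc (count M j)) * mfps_coeff (taylor g * taylor h) (add_mset j M)"
      by (simp only: add.IH taylor_d mfps_coeff_deriv[symmetric] mfps_deriv_mult plus_mfps.rep_eq)
    finally show ?case by (simp del: of_nat_Suc)
  qed
qed

lemma vanishing_iff: "g \<in> vanishing k \<longleftrightarrow> (\<forall>M. size M < k \<longrightarrow> mfps_coeff (taylor g) M = 0)"
proof (induction k arbitrary: g)
  case (Suc k)
  have "g \<in> vanishing (Suc k) \<longleftrightarrow>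
      \<theta> g = 0 \<and> (\<forall>j M. size M < k \<longrightarrow> \<theta> (dpow (add_mset j M) g) = 0)"
    by (auto simp: Suc dpow_add_mset coeff_taylor_eq_0_iff)
  also have "\<dots> \<longleftrightarrow> (\<forall>M. size M < Suc k \<longrightarrow> \<theta> (dpow M g) = 0)"
  proof (intro iffI allI impI conjI)
    fix M :: "'n multiset"
    assume g: "\<theta> g = 0 \<and> (\<forall>j M. size M < k \<longrightarrow> \<theta> (dpow (add_mset j M) g) = 0)" and M: "size M < Suc k"
    show "\<theta> (dpow M g) = 0" by (cases M) (use g M in \<open>auto simp: dpow_empty\<close>)
  next
    assume g: "\<forall>M. size M < Suc k \<longrightarrow> \<theta> (dpow M g) = 0"
    show "\<theta> g = 0" using g[rule_format, of "{#}"] by (simp add: dpow_empty)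
    show "\<theta> (dpow (add_mset j M) g) = 0" if "size M < k" for j :: 'n and M using g that by simp
  qed
  finally show ?case by (simp only: coeff_taylor_eq_0_iff)
qed simp

lemma inj_taylor: "inj taylor"
proof (rule injI)
  fix g h assume "taylor g = taylor h"
  then have "taylor (g - h) = 0" by (simp add: taylor_diff)
  then have "g - h \<in> vanishing k" for k by (simp add: vanishing_iff zero_mfps.rep_eq)
  then have "g - h = 0" by (rule vanishing_inter)
  then show "g = h" by simp
qed

lemma taylor_monomial: "\<exists>g. taylor g = mfps_monom M"
proof (induction M)
  case empty
  show ?case using taylor_1 by (auto simp: mfps_monom_empty)
next
  case (add j M)
  then obtain g where g: "taylor g = mfps_monom M" ..
  define y where "y = x j - \<theta> (x j) \<cdot> 1"
  have "taylor y = mfps_monom {#j#}"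
  proof (unfold mfps_eq_iff, intro allI)
    fix N
    show "mfps_coeff (taylor y) N = mfps_coeff (mfps_monom {#j#}) N"
    proof (cases N)
      case empty
      then show ?thesis by (simp add: coeff_taylor dpow_empty y_def \<theta>_diff \<theta>_scale \<theta>_1 mfps_coeff_monom)
    next
      case (add i N')
      have "d i y + d i (\<theta> (x j) \<cdot> 1) = d i (x j)" unfolding d_add[symmetric] by (simp add: y_def)
      then have "d i y = (if i = j then 1 else 0)" by (simp add: d_scale d_1 d_x)
      then have "taylor (d i y) = (if i = j then 1 else 0)" by (simp add: taylor_1 taylor_0)
      then have "of_nat (Suc (count N' i)) * mfps_coeff (taylor y) N =
          mfps_coeff (if i = j then 1 else 0 :: ('f, 'n) mfps) N'"
        unfolding add mfps_coeff_deriv[symmetric] taylor_d[symmetric] by simp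
      also have "\<dots> = of_nat (Suc (count N' i)) * mfps_coeff (mfps_monom {#j#}) N"
        by (simp add: add mfps_coeff_monom one_mfps.rep_eq zero_mfps.rep_eq add_eq_conv_diff)
      finally show ?thesis by (simp del: of_nat_Suc)
    qed
  qed
  then have "taylor (y * g) = mfps_monom (add_mset j M)"
    by (simp add: taylor_mult g mfps_monom_mult)
  then show ?case ..
qed

text \<open>
  The elements whose Taylor series agrees with \<open>F\<close> in degrees less than \<open>k\<close> form a nonempty closed
  affine subspace with direction \<open>vanishing k\<close>; compactness gives an element common to all of them.
\<close>

lemma surj_taylor: "\<exists>g. taylor g = F"
proof -
  define A where "A k = {g. \<forall>M. size M < k \<longrightarrow> mfps_coeff (taylor g) M = mfps_coeff F M}" for k
  have affine: "h \<in> A k \<longleftrightarrow> h - g \<in> vanishing k" if "g \<in> A k" for g h k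
    using that by (auto simp: A_def vanishing_iff taylor_diff minus_mfps.rep_eq)
  have ne: "A k \<noteq> {}" for k
  proof (induction k)
    case 0
    show ?case by (simp add: A_def)
  next
    case (Suc k)
    then obtain g where g: "g \<in> A k" by blast
    have "\<forall>M. \<exists>h. taylor h = mfps_monom M" using taylor_monomial by simp
    from choice[OF this] obtain X where X: "\<forall>M. taylor (X M) = mfps_monom M" ..
    define c where "c M = mfps_coeff F M - mfps_coeff (taylor g) M" for M
    define h where "h = g + (\<Sum>M | size M = k. c M \<cdot> X M)"
    have "mfps_coeff (taylor h) N = mfps_coeff F N" if N: "size N < Suc k" for N
    proof -
      have "mfps_coeff (taylor h) N = mfps_coeff (taylor g) N + (\<Sum>M | size M = k. if N = M then c N else 0)"
        unfolding h_def taylor_add taylor_sum taylor_scale plus_mfps.rep_eq mfps_coeff_sum mfps_scale.rep_eq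
          X[rule_format] mfps_coeff_monom
        by (intro arg_cong2[of _ _ _ _ "(+)"] refl sum.cong) auto
      also have "\<dots> = mfps_coeff (taylor g) N + (if size N = k then c N else 0)"
        by (simp add: finite_multisets_size)
      also have "\<dots> = mfps_coeff F N"
        using N g by (auto simp: c_def A_def less_Suc_eq)
      finally show ?thesis .
    qed
    then have "h \<in> A (Suc k)" by (simp add: A_def)
    then show ?case by blast
  qed
  obtain g where g: "\<And>k. g \<in> A k"
  proof (rule decreasing_closed_affine_inter[of A vanishing])
    show "closedin T (A k)" for k
    proof -
      obtain g where "g \<in> A k" using ne by blast
      then have "A k = {h. h - g \<in> vanishing k}" using affine by blast
      then show ?thesis using closedin_translate[OF closedin_vanishing] by simp
    qed
    show "A (Suc k) \<subseteq> A k" for k by (auto simp: A_def)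
    show "subspace (vanishing k)" for k by (rule alg_idealD(1)[OF alg_ideal_vanishing])
  qed (use ne affine in \<open>auto intro: that\<close>)
  have "taylor g = F"
    unfolding mfps_eq_iff
  proof
    fix M
    show "mfps_coeff (taylor g) M = mfps_coeff F M" using g[of "Suc (size M)"] by (simp add: A_def)
  qed
  then show ?thesis ..
qed

lemma bij_taylor: "bij taylor"
  using inj_taylor surj_taylor by (metis bij_betw_def surj_def)

lemma openin_coeff_taylor_kernel: "openin T {g. mfps_coeff (taylor g) M = 0}"
  unfolding coeff_taylor_eq_0_iff
proof (induction M)
  case empty
  show ?case using \<theta>_open by (simp add: dpow_empty)
next
  case (add j M)
  have "continuous_map T T (d j)" by (rule D_continuous) simp
  from openin_continuous_map_preimage[OF this add] show ?case by (simp add: dpow_add_mset)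
qed

lemma continuous_coeff_taylor:
  "continuous_map T (discrete_topology UNIV) (\<lambda>g. mfps_coeff (taylor g) M)"
  unfolding continuous_map_def
proof (intro conjI allI impI)
  fix S :: "'f set"
  show "openin T {g \<in> topspace T. mfps_coeff (taylor g) M \<in> S}"
  proof (subst openin_subopen, intro ballI)
    fix g assume g: "g \<in> {g \<in> topspace T. mfps_coeff (taylor g) M \<in> S}"
    let ?U = "{h. h - g \<in> {g. mfps_coeff (taylor g) M = 0}}"
    have "openin T ?U" by (rule openin_translate[OF openin_coeff_taylor_kernel])
    moreover have "g \<in> ?U" by (simp add: taylor_0 zero_mfps.rep_eq)
    moreover have "?U \<subseteq> {g \<in> topspace T. mfps_coeff (taylor g) M \<in> S}"
      using g by (auto simp: taylor_diff minus_mfps.rep_eq)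
    ultimately show "\<exists>U. openin T U \<and> g \<in> U \<and> U \<subseteq> {g \<in> topspace T. mfps_coeff (taylor g) M \<in> S}"
      by (intro exI[of _ ?U] conjI)
  qed
qed simp

lemma topspace_mfps_topology: "topspace mfps_topology = UNIV"
  by (simp add: mfps_topology_def topspace_pullback_topology)

lemma homeomorphic_taylor: "homeomorphic_map T mfps_topology taylor"
proof (rule bijective_open_imp_homeomorphic_map)
  show "continuous_map T mfps_topology taylor"
    unfolding mfps_topology_def
    by (rule continuous_map_pullback')
       (simp_all add: continuous_map_componentwise_UNIV comp_def continuous_coeff_taylor)
  show "taylor ` topspace T = topspace mfps_topology"
    using bij_taylor by (simp add: topspace_mfps_topology bij_is_surj)
  show "inj_on taylor (topspace T)" using inj_taylor by simp
  show "open_map T mfps_topology taylor"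
    unfolding open_map_def
  proof (intro allI impI)
    fix U assume U: "openin T U"
    show "openin mfps_topology (taylor ` U)"
    proof (subst openin_subopen, intro ballI)
      fix F assume "F \<in> taylor ` U"
      then obtain g where g: "g \<in> U" "F = taylor g" by blast
      obtain W where W: "subspace W" "openin T W" "\<forall>h. h - g \<in> W \<longrightarrow> h \<in> U"
        by (rule openin_nbhd[OF U g(1)])
      obtain k where k: "vanishing k \<subseteq> W" by (rule vanishing_subset_open[OF W(2,1)])
      define P where "P = PiE UNIV (\<lambda>M. if size M < k then {mfps_coeff F M} else UNIV)"
      have "{M :: 'n multiset. size M < k} = (\<Union>m<k. {M. size M = m})" by auto
      then have fin: "finite {M :: 'n multiset. size M < k}" by (simp add: finite_multisets_size)
      have "openin (product_topology (\<lambda>_ :: 'n multiset. discrete_topology (UNIV :: 'f set)) UNIV) P"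
        unfolding P_def
      proof (rule product_topology_basis)
        show "finite {M. (if size M < k then {mfps_coeff F M} else UNIV) \<noteq> topspace (discrete_topology (UNIV :: 'f set))}"
          by (rule finite_subset[OF _ fin]) auto
      qed simp
      then have "openin mfps_topology (mfps_coeff -` P \<inter> UNIV)"
        unfolding mfps_topology_def openin_pullback_topology by blast
      moreover have "F \<in> mfps_coeff -` P \<inter> UNIV" by (simp add: P_def PiE_iff)
      moreover have "mfps_coeff -` P \<inter> UNIV \<subseteq> taylor ` U"
      proof
        fix G assume G: "G \<in> mfps_coeff -` P \<inter> UNIV"
        obtain h where h: "taylor h = G" using surj_taylor by blast
        have "mfps_coeff G M = mfps_coeff F M" if "size M < k" for M
        proof -
          have "mfps_coeff G M \<in> (if size M < k then {mfps_coeff F M} else UNIV)"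
            using G by (auto simp: P_def PiE_iff)
          then show ?thesis using that by simp
        qed
        then have "h - g \<in> vanishing k"
          by (simp add: vanishing_iff taylor_diff minus_mfps.rep_eq h g(2)[symmetric])
        then have "h \<in> U" using k W(3) by blast
        then show "G \<in> taylor ` U" using h by blast
      qed
      ultimately show "\<exists>S. openin mfps_topology S \<and> F \<in> S \<and> S \<subseteq> taylor ` U" by blast
    qed
  qed
qed

lemma taylor_det:
  "taylor (det (\<chi> i j. m i j)) = det (\<chi> i j. taylor (m i j))" for m :: "'n \<Rightarrow> 'n \<Rightarrow> 'a"
proof -
  have prod: "taylor (prod F S) = (\<Prod>s\<in>S. taylor (F s))" for F :: "'n \<Rightarrow> 'a" and S
    by (induction S rule: infinite_finite_induct) (simp_all add: taylor_1 taylor_mult)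
  have sgn: "taylor (of_int (sign p)) = of_int (sign p)" for p :: "'n \<Rightarrow> 'n"
    using taylor_diff[of 0 1] by (simp add: sign_def taylor_1 taylor_0)
  show ?thesis by (simp add: det_def taylor_sum taylor_mult prod sgn)
qed

end

section \<open>Simple linearly compact Nambu-Poisson algebras\<close>

context linearly_compact_nambu_poisson_algebra
begin

lemma continuous_bracket_slot: "continuous_map T T (\<lambda>g. bracket (a(k := g)))"
proof -
  have top: "topspace T = UNIV" using linearly_compact by (simp add: linearly_compact_def)
  have "continuous_map T (product_topology (\<lambda>_. T) UNIV) (\<lambda>g. a(k := g))"
    unfolding continuous_map_componentwise_UNIV
    using top by (auto simp: fun_upd_def)
  from continuous_map_compose[OF this continuous_bracket] show ?thesis by (simp add: comp_def)
qed

end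

locale simple_linearly_compact_nambu_poisson_algebra =
  linearly_compact_nambu_poisson_algebra smul bracket T +
  linearly_compact_algebra_acf smul T +
  nambu_poisson_algebra_char_0 smul bracket
  for smul :: "'f::{alg_closed_field, field_char_0} \<Rightarrow> 'a::comm_ring_1 \<Rightarrow> 'a"
    and bracket :: "('n::finite \<Rightarrow> 'a) \<Rightarrow> 'a" and T :: "'a topology" +
  assumes simple: simple
begin

lemma ideal_trivial:
  assumes "alg_ideal J" "\<And>a k x. x \<in> J \<Longrightarrow> bracket (a(k := x)) \<in> J"
  shows "J = {0} \<or> J = UNIV"
proof -
  have "bracket a \<in> J" if "a k \<in> J" for a k
    using assms(2)[OF that, of a k] by simp
  then have "np_ideal J" using assms(1) by (auto simp: np_ideal_def alg_ideal_def)
  then show ?thesis using simple by (auto simp: simple_def)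
qed

text \<open>
  If \<open>\<theta>\<close> annihilated all brackets, its kernel would be a proper ideal, hence zero; the algebra would consist of
  scalars only, and the bracket would vanish.
\<close>

lemma unit_bracket:
  obtains \<theta> f v where "differentially_simple_algebra smul T \<theta> (range (\<lambda>(a, k) g. bracket (a(k := g))))"
    "bracket f * v = 1"
proof -
  obtain \<theta> :: "'a \<Rightarrow> 'f" where \<theta>: "\<forall>x y. \<theta> (x + y) = \<theta> x + \<theta> y" "\<forall>c x. \<theta> (c \<cdot> x) = c * \<theta> x"
    "\<forall>x y. \<theta> (x * y) = \<theta> x * \<theta> y" "\<theta> 1 = 1" "openin T {x. \<theta> x = 0}"
    by (rule continuous_character)
  interpret differentially_simple_algebra smul T \<theta> "range (\<lambda>(a, k) g. bracket (a(k := g)))"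
  proof (unfold_locales, goal_cases)
    case (10 J)
    show ?case
    proof (rule ideal_trivial[OF 10(1)])
      show "bracket (a(k := x)) \<in> J" if "x \<in> J" for a k x
        using 10(2)[of "\<lambda>g. bracket (a(k := g))" x] that by force
    qed
  qed (use \<theta> in \<open>auto simp: bracket_add bracket_scale leibniz continuous_bracket_slot\<close>)
  have "\<exists>f. \<theta> (bracket f) \<noteq> 0"
  proof (rule ccontr)
    assume "\<not> ?thesis"
    then have 0: "\<theta> (bracket f) = 0" for f by blast
    have "alg_ideal {x. \<theta> x = 0}"
      by (rule alg_idealI) (simp_all add: \<theta>_0 \<theta>_add \<theta>_mult)
    then have "{x. \<theta> x = 0} = {0} \<or> {x. \<theta> x = 0} = UNIV"
      by (rule ideal_trivial) (simp add: 0)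
    moreover have "{x. \<theta> x = 0} \<noteq> UNIV"
    proof -
      have "1 \<notin> {x. \<theta> x = 0}" by (simp add: \<theta>_1)
      then show ?thesis by blast
    qed
    ultimately have ker: "x = 0" if "\<theta> x = 0" for x using that by blast
    have scalar: "x = \<theta> x \<cdot> 1" for x
      using ker[of "x - \<theta> x \<cdot> 1"] by (simp add: \<theta>_diff \<theta>_scale \<theta>_1)
    have "bracket a = 0" for a
    proof -
      obtain k :: 'n where True by blast
      have "bracket (a(k := 1 * 1)) = bracket (a(k := 1)) * 1 + 1 * bracket (a(k := 1))"
        by (rule leibniz)
      then have "bracket (a(k := 1)) = 0" by simp
      then have "bracket (a(k := \<theta> (a k) \<cdot> 1)) = 0" by (simp only: bracket_scale scale_zero_right)
      then show ?thesis using scalar[of "a k"] by simp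
    qed
    then show False using simple by (simp add: simple_def)
  qed
  then obtain f where "\<theta> (bracket f) \<noteq> 0" ..
  then obtain v where "bracket f * v = 1" by (rule invertible)
  then show ?thesis using differentially_simple_algebra_axioms by (intro that)
qed

text \<open>
  By the frame expansion, an ideal stable under the derivations dual to a frame is stable under
  the bracket, hence it is trivial.
\<close>

lemma coordinate_derivations_frame:
  assumes frame: "nambu_frame smul bracket f v"
    and ds: "differentially_simple_algebra smul T \<theta> (range (\<lambda>(a, k) g. bracket (a(k := g))))"
  shows "coordinate_derivations smul T \<theta> (nambu_frame.der bracket f v) f"
proof -
  interpret nambu_frame smul bracket f v by (rule frame)
  interpret ds: differentially_simple_algebra smul T \<theta> "range (\<lambda>(a, k) g. bracket (a(k := g)))"
    by (rule ds)
  have cont: "continuous_map T T (der i)" for i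
    using continuous_map_compose[OF continuous_bracket_slot[of f i] ds.continuous_mult_left[of v]]
    by (simp add: der_def[abs_def] comp_def)
  show ?thesis
  proof (unfold_locales, goal_cases)
    case (10 J)
    show ?case
    proof (rule ideal_trivial[OF 10(1)])
      fix a k x assume x: "x \<in> J"
      have "bracket (a(k := x)) = (\<Sum>i\<in>UNIV. bracket (a(k := f i)) * der i x)"
        by (subst frame_expansion) (simp add: mult.commute)
      also have "\<dots> \<in> J"
        using 10(2)[OF _ x] by (intro subspace_sum alg_idealD[OF 10(1)]) auto
      finally show "bracket (a(k := x)) \<in> J" .
    qed
  next
    case (11 i j g)
    show ?case by (rule der_commute)
  next
    case (12 i j)
    show ?case by (rule der_f)
  qed (auto simp: ds.\<theta>_add ds.\<theta>_scale ds.\<theta>_mult ds.\<theta>_1 ds.\<theta>_open der_add der_scale der_mult cont)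
qed

theorem isomorphic_power_series:
  assumes card: "CARD('n) > 2"
  shows "\<exists>\<phi> :: 'a \<Rightarrow> ('f, 'n) mfps.
    nambu_poisson_iso smul bracket T mfps_scale jacobian_bracket mfps_topology \<phi>"
proof -
  obtain \<theta> f v where ds: "differentially_simple_algebra smul T \<theta> (range (\<lambda>(a, k) g. bracket (a(k := g))))"
    and v: "bracket f * v = 1" by (rule unit_bracket)
  interpret A: nambu_frame smul bracket f v
    by unfold_locales (fact card v)+
  interpret A: coordinate_derivations smul T \<theta> A.der f
    by (rule coordinate_derivations_frame[OF A.nambu_frame_axioms ds])
  obtain k :: 'n where True by blast
  \<comment> \<open>Replace one frame element so that the bracket of the frame becomes \<open>1\<close>.\<close>
  obtain G where G: "mfps_deriv k G = A.taylor v" by (rule mfps_antiderivative)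
  obtain g where g: "A.taylor g = G" using A.surj_taylor by blast
  have "A.taylor (A.der k g) = A.taylor v" by (simp only: A.taylor_d g G)
  then have "A.der k g = v" using A.inj_taylor by (simp add: inj_eq)
  define x where "x = f(k := g)"
  have x: "bracket x = 1"
    unfolding x_def A.bracket_f_upd using \<open>A.der k g = v\<close> v by simp
  interpret B: nambu_frame smul bracket x 1
    by unfold_locales (simp_all add: card x)
  interpret B: coordinate_derivations smul T \<theta> B.der x
    by (rule coordinate_derivations_frame[OF B.nambu_frame_axioms ds])
  have "nambu_poisson_iso smul bracket T mfps_scale jacobian_bracket mfps_topology B.taylor"
    unfolding nambu_poisson_iso_def
  proof (intro conjI allI)
    show "bij B.taylor" by (rule B.bij_taylor)
    show "Vector_Spaces.linear smul mfps_scale B.taylor"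
      unfolding Vector_Spaces.linear_iff
      by (intro conjI allI B.taylor_add B.taylor_scale)
         (unfold_locales, auto simp: mfps_eq_iff mfps_scale.rep_eq plus_mfps.rep_eq algebra_simps)
    show "B.taylor 1 = 1" by (rule B.taylor_1)
    show "B.taylor (y * z) = B.taylor y * B.taylor z" for y z by (rule B.taylor_mult)
    show "B.taylor (bracket a) = jacobian_bracket (B.taylor \<circ> a)" for a
    proof -
      have "bracket a = det (\<chi> i j. B.der j (a i))" using B.bracket_eq_det[of a] x by simp
      then show ?thesis by (simp add: B.taylor_det B.taylor_d jacobian_bracket_def)
    qed
    show "homeomorphic_map T mfps_topology B.taylor" by (rule B.homeomorphic_taylor)
  qed
  then show ?thesis by (intro exI[of _ B.taylor])
qed

end

theorem theorem0p1:
  fixes smul :: "'f::{alg_closed_field, field_char_0} \<Rightarrow> 'a::comm_ring_1 \<Rightarrow> 'a"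
    and bracket :: "('n::finite \<Rightarrow> 'a) \<Rightarrow> 'a"
    and T :: "'a topology"
  assumes "CARD('n) > 2"
    and "linearly_compact_nambu_poisson_algebra smul bracket T"
    and "nambu_poisson_algebra.simple smul bracket"
  shows "\<exists>\<phi> :: 'a \<Rightarrow> ('f, 'n) mfps.
    nambu_poisson_iso smul bracket T mfps_scale jacobian_bracket mfps_topology \<phi>"
proof -
  interpret linearly_compact_nambu_poisson_algebra smul bracket T by (rule assms(2))
  interpret simple_linearly_compact_nambu_poisson_algebra smul bracket T
    by unfold_locales (fact linearly_compact smul_mult continuous_mult assms(3))+
  show ?thesis by (rule isomorphic_power_series[OF assms(1)])
qed

end
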